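(* Let $\kappa_0\in\mathbb C\setminus\mathrm i\mathbb R$ and $\eta\in\hat{\mathbb C}$. Then there exists $\delta>0$ such that the control system is small-time local controllable (STLC) to $\eta$ uniformly over $\mathbb D_\delta(\kappa_0)$ if and only if $\eta\in(-n_2,-n_1)\cup(n_1,n_2)$. The same equivalence holds with "STLC to $\eta$" replaced by "STLC from $\eta$".
   Context: Fix constants $0<n_1<n_2$ and $s_-\in\mathbb R$; $\hat{\mathbb C}=\mathbb C\cup\{\infty\}$, $\mathbb D_r(z)=\{w\in\mathbb C:|w-z|<r\}$ (so $\mathbb D_0(z)=\varnothing$). Feasible controls are $\varepsilon\in L^\infty((s_-,\infty);\mathbb R)$ with $n_1^2\le\varepsilon\le n_2^2$ a.e. For $\kappa\in\mathbb C$, the state $x(s)\in\hat{\mathbb C}$ of the control system evolves by $x'=\mathrm i\kappa(-x^2+\varepsilon)$ in the chart $\mathbb C$ and, near $\infty$, by $\tilde x'=\mathrm i\kappa(-1+\varepsilon\tilde x^2)$ for $\tilde x=-1/x$. $\mathfrak C_{[0,t)}(\eta,\kappa)$ is the set of initial states $x(s_-)$ that can be steered to $\eta$ by a feasible control in some time $t_0\in[0,t)$; $\mathfrak R_{[0,t)}(\eta,\kappa)$ is the set of states that can be reached from $x(s_-)=\eta$ by a feasible control in some time $t_0\in[0,t)$. Put $r^{\max}(t;\eta,\kappa)=\sup\{r\ge0:\mathbb D_r(\eta)\subset\mathfrak C_{[0,t)}(\eta,\kappa)\}$. For $\Omega\subset\mathbb C$, the system is STLC to $\eta$ uniformly over $\Omega$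 if there exist $\delta_1>0$ and a strictly increasing continuous function $r^{\max}_{\Omega,\eta}:[0,\delta_1)\to[0,+\infty)$ such that $r^{\max}_{\Omega,\eta}(t)\le r^{\max}(t;\eta,\kappa)$ for all $\kappa\in\Omega$ and $t\in[0,\delta_1)$. STLC from $\eta$ uniformly over $\Omega$ is defined in the same way with $\mathfrak R_{[0,t)}(\eta,\kappa)$ in place of $\mathfrak C_{[0,t)}(\eta,\kappa)$. For $\eta=\infty$, the discs around $\eta$ are understood in the local coordinate $\tilde x=-1/x$. *)

theory Defs
  imports "HOL-Analysis.Analysis"
begin

text \<open>
  The Riemann sphere is represented by \<^typ>\<open>complex option\<close>, with \<^const>\<open>None\<close> as the point at
  infinity (the carrier that \<^const>\<open>Alexandroff_compactification\<close> puts on the one-point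
  compactification of the plane).
\<close>

type_synonym csphere = "complex option"

abbreviation infty :: csphere where "infty \<equiv> None"

abbreviation fin :: "complex \<Rightarrow> csphere" where "fin \<equiv> Some"

text \<open>The coordinate \<open>-1/x\<close>; it is a chart on the complement of \<open>fin 0\<close>, where its value is junk.\<close>

fun chart_infty :: "csphere \<Rightarrow> complex" where
  "chart_infty None = 0"
| "chart_infty (Some z) = - 1 / z"

fun disc :: "csphere \<Rightarrow> real \<Rightarrow> csphere set" where
  "disc (Some z) r = fin ` ball z r"
| "disc None r = {x. x \<noteq> fin 0 \<and> chart_infty x \<in> ball 0 r}"

text \<open>
  The bounds on the control are required almost everywhere; an element of
  \<open>L\<^sup>\<infinity>((s\<^sub>-, \<infinity>); \<real>)\<close> is given by any Lebesgue measurable representative.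
\<close>

definition feasible :: "real \<Rightarrow> real \<Rightarrow> real \<Rightarrow> (real \<Rightarrow> real) \<Rightarrow> bool" where
  "feasible n\<^sub>1 n\<^sub>2 s\<^sub>0 \<epsilon> \<longleftrightarrow>
     \<epsilon> \<in> borel_measurable (lebesgue_on {s\<^sub>0<..}) \<and>
     (AE s in lebesgue_on {s\<^sub>0<..}. n\<^sub>1\<^sup>2 \<le> \<epsilon> s \<and> \<epsilon> s \<le> n\<^sub>2\<^sup>2)"

text \<open>
  The controls are only measurable, so solutions are Caratheodory solutions: absolutely continuous
  functions satisfying the differential equation almost everywhere. On an interval \<open>J\<close> these are
  the functions that satisfy the integrated equation with a Lebesgue integrable right-hand side.
\<close>

definition caratheodory_solution ::
    "real set \<Rightarrow> (real \<Rightarrow> complex \<Rightarrow> complex) \<Rightarrow> (real \<Rightarrow> complex) \<Rightarrow> bool" where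
  "caratheodory_solution J f z \<longleftrightarrow>
     (\<forall>a\<in>J. \<forall>b\<in>J. a \<le> b \<longrightarrow>
        (\<lambda>s. f s (z s)) absolutely_integrable_on {a..b} \<and>
        z b - z a = integral {a..b} (\<lambda>s. f s (z s)))"

text \<open>
  Being a trajectory is local in time: near each time the state stays in one of the two charts and
  solves the equation of that chart.
\<close>

definition trajectory ::
    "complex \<Rightarrow> (real \<Rightarrow> real) \<Rightarrow> real \<Rightarrow> real \<Rightarrow> (real \<Rightarrow> csphere) \<Rightarrow> bool" where
  "trajectory \<kappa> \<epsilon> a b x \<longleftrightarrow>
     (\<forall>s\<in>{a..b}. \<exists>h>0. let J = {a..b} \<inter> {s - h..s + h} in
        ((\<forall>u\<in>J. x u \<noteq> infty) \<and>
          caratheodory_solution J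
            (\<lambda>u z. \<i> * \<kappa> * (- z\<^sup>2 + complex_of_real (\<epsilon> u))) (\<lambda>u. the (x u))) \<or>
        ((\<forall>u\<in>J. x u \<noteq> fin 0) \<and>
          caratheodory_solution J
            (\<lambda>u z. \<i> * \<kappa> * (- 1 + complex_of_real (\<epsilon> u) * z\<^sup>2)) (\<lambda>u. chart_infty (x u))))"

definition steers ::
    "real \<Rightarrow> real \<Rightarrow> real \<Rightarrow> complex \<Rightarrow> real \<Rightarrow> csphere \<Rightarrow> csphere \<Rightarrow> bool" where
  "steers n\<^sub>1 n\<^sub>2 s\<^sub>0 \<kappa> t\<^sub>0 p q \<longleftrightarrow>
     (\<exists>\<epsilon> x. feasible n\<^sub>1 n\<^sub>2 s\<^sub>0 \<epsilon> \<and> trajectory \<kappa> \<epsilon> s\<^sub>0 (s\<^sub>0 + t\<^sub>0) x \<and>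
            x s\<^sub>0 = p \<and> x (s\<^sub>0 + t\<^sub>0) = q)"

definition controllable_set ::
    "real \<Rightarrow> real \<Rightarrow> real \<Rightarrow> csphere \<Rightarrow> complex \<Rightarrow> real \<Rightarrow> csphere set" where
  "controllable_set n\<^sub>1 n\<^sub>2 s\<^sub>0 \<eta> \<kappa> t = {p. \<exists>t\<^sub>0\<in>{0..<t}. steers n\<^sub>1 n\<^sub>2 s\<^sub>0 \<kappa> t\<^sub>0 p \<eta>}"

definition reachable_set ::
    "real \<Rightarrow> real \<Rightarrow> real \<Rightarrow> csphere \<Rightarrow> complex \<Rightarrow> real \<Rightarrow> csphere set" where
  "reachable_set n\<^sub>1 n\<^sub>2 s\<^sub>0 \<eta> \<kappa> t = {q. \<exists>t\<^sub>0\<in>{0..<t}. steers n\<^sub>1 n\<^sub>2 s\<^sub>0 \<kappa> t\<^sub>0 \<eta> q}"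

text \<open>The supremum may be infinite, hence the extended reals.\<close>

definition r_max :: "csphere \<Rightarrow> csphere set \<Rightarrow> ereal" where
  "r_max \<eta> S = Sup {ereal r | r. 0 \<le> r \<and> disc \<eta> r \<subseteq> S}"

text \<open>\<open>A \<kappa> t\<close> is the set that has to contain discs around \<open>\<eta>\<close>.\<close>

definition uniform_disc_bound ::
    "csphere \<Rightarrow> (complex \<Rightarrow> real \<Rightarrow> csphere set) \<Rightarrow> complex set \<Rightarrow> bool" where
  "uniform_disc_bound \<eta> A \<Omega> \<longleftrightarrow>
     (\<exists>\<delta>\<^sub>1>0. \<exists>\<rho> :: real \<Rightarrow> real.
        strict_mono_on {0..<\<delta>\<^sub>1} \<rho> \<and> continuous_on {0..<\<delta>\<^sub>1} \<rho> \<and> (\<forall>t\<in>{0..<\<delta>\<^sub>1}. 0 \<le> \<rho> t) \<and>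
        (\<forall>\<kappa>\<in>\<Omega>. \<forall>t\<in>{0..<\<delta>\<^sub>1}. ereal (\<rho> t) \<le> r_max \<eta> (A \<kappa> t)))"

definition stlc_to :: "real \<Rightarrow> real \<Rightarrow> real \<Rightarrow> csphere \<Rightarrow> complex set \<Rightarrow> bool" where
  "stlc_to n\<^sub>1 n\<^sub>2 s\<^sub>0 \<eta> \<Omega> \<longleftrightarrow> uniform_disc_bound \<eta> (controllable_set n\<^sub>1 n\<^sub>2 s\<^sub>0 \<eta>) \<Omega>"

definition stlc_from :: "real \<Rightarrow> real \<Rightarrow> real \<Rightarrow> csphere \<Rightarrow> complex set \<Rightarrow> bool" where
  "stlc_from n\<^sub>1 n\<^sub>2 s\<^sub>0 \<eta> \<Omega> \<longleftrightarrow> uniform_disc_bound \<eta> (reachable_set n\<^sub>1 n\<^sub>2 s\<^sub>0 \<eta>) \<Omega>"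

end

theory Submission
  imports Defs
begin

text \<open>
  Why the theorem is true. Write \<open>\<kappa> = k + \<i> l\<close> and \<open>x = X + \<i> Y\<close>.

  Let \<open>\<eta>\<close> be real with \<open>n\<^sub>1 < \<bar>\<eta>\<bar> < n\<^sub>2\<close>. The constant control \<open>\<eta>\<^sup>2\<close>, which is interior to the
  control range, keeps the state at rest at \<open>\<eta>\<close>. The control only pushes in the direction
  \<open>\<i> \<kappa>\<close>, but the drift \<open>- 2 \<i> \<kappa> \<eta>\<close> of the linearization turns this direction, because \<open>k \<noteq> 0\<close>.
  The form of this remark used here is flatness. The real quantity \<open>Q = k X + l Y\<close>, the component
  of \<open>x\<close> to which the control does not contribute, satisfies \<open>Q' = 2 \<bar>\<kappa>\<bar>\<^sup>2 X Y\<close>, and near \<open>\<eta>\<close> the pair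
  \<open>(Q, X Y)\<close> determines \<open>(X, Y)\<close>, by a quadratic equation that is nondegenerate as long as
  \<open>k X \<noteq> l Y\<close>. So any real function \<open>Q\<close>
  that is close in \<open>C\<^sup>2\<close> to the constant \<open>k \<eta>\<close> is the output of a trajectory, whose control is an
  explicit continuous function of \<open>Q, Q', Q''\<close> near \<open>\<eta>\<^sup>2\<close> (\<open>flat_derivatives\<close>,
  \<open>flat_near_equilibrium\<close>). Two states whose distance from \<open>\<eta>\<close> is a small multiple of \<open>T\<^sup>2\<close> are
  joined in time \<open>T\<close> by the cubic that has the values of \<open>Q\<close> and \<open>Q'\<close> of these states at its ends: up
  to a constant, its second derivative is bounded by the distance over \<open>T\<^sup>2\<close> (\<open>flat_interpolation\<close>, \<open>steers_near_equilibrium\<close>). This gives discs of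
  radius \<open>c T\<^sup>2\<close>, with \<open>c\<close> independent of \<open>\<kappa>\<close> near \<open>\<kappa>\<^sub>0\<close>, in both the controllable and the
  reachable set.

  Conversely let \<open>\<eta>\<close> be any other finite point. Then \<open>\<eta>\<^sup>2\<close> is not in the open segment between
  \<open>n\<^sub>1\<^sup>2\<close> and \<open>n\<^sub>2\<^sup>2\<close>, so all values \<open>\<epsilon> - \<eta>\<^sup>2\<close> lie in a sector \<open>c \<bar>v\<bar> \<le> Re (cnj d v)\<close> with \<open>c > 0\<close>
  (\<open>segment_in_sector\<close>; if \<open>\<eta>\<close> is one of \<open>\<plusminus>n\<^sub>1, \<plusminus>n\<^sub>2\<close>, the value \<open>0\<close> occurs, but the others still
  have one sign). The displacement \<open>z = x - \<eta>\<close> satisfies \<open>z' = g - \<i> \<kappa> (x + \<eta>) z\<close> with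
  \<open>g = \<i> \<kappa> (\<epsilon> - \<eta>\<^sup>2)\<close>. If \<open>z\<close> vanishes at one end of a short time interval, then \<open>\<bar>z\<bar>\<close> is at most twice
  the integral of \<open>\<bar>g\<bar>\<close>, so the \<open>z\<close> term is negligible against the integral of \<open>g\<close>, and the
  total displacement lies in a half plane that does not depend on the control
  (\<open>half_plane_drift\<close>). The states on the wrong side of \<open>\<eta>\<close>
  are out of reach, however close to \<open>\<eta>\<close> they are. At \<open>\<infinity>\<close> the same argument applies to \<open>- 1 / x\<close>,
  with the constant drift \<open>g = - \<i> \<kappa>\<close>.

  For this estimate the path has to stay in one chart. The two charts carry the equations
  \<open>y' = \<i> \<kappa> (A + B y\<^sup>2)\<close> with the coefficients \<open>A, B\<close> interchanged; \<open>riccati_chart_change\<close> is the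
  chain rule for Caratheodory solutions that makes the change legitimate, and
  \<open>two_chart_path_confined\<close> bounds the time needed to leave a disc.
\<close>

section \<open>Steering near a real equilibrium by a flat output\<close>

text \<open>
  The coordinates of the state in terms of the flat output \<open>Q = k X + l Y\<close> and of
  \<open>W = X Y = Q' / (2 \<bar>\<kappa>\<bar>\<^sup>2)\<close>: \<open>X\<close> is a root of \<open>k X\<^sup>2 - Q X + l W\<close>. The sign \<open>\<sigma>\<close> chooses the branch; near
  \<open>\<eta>\<close> it is the sign of \<open>k \<eta>\<close>. This form of the root has no singularity at \<open>l = 0\<close>.
\<close>
definition flat_re :: "real \<Rightarrow> real \<Rightarrow> real \<Rightarrow> real \<Rightarrow> real \<Rightarrow> real" where
  "flat_re \<sigma> k l Q W = (Q + \<sigma> * sqrt (Q\<^sup>2 - 4 * k * l * W)) / (2 * k)"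

definition flat_im :: "real \<Rightarrow> real \<Rightarrow> real \<Rightarrow> real \<Rightarrow> real \<Rightarrow> real" where
  "flat_im \<sigma> k l Q W = W / flat_re \<sigma> k l Q W"

text \<open>
  The real part of \<open>x' / (\<i> \<kappa>)\<close> along the curve, where \<open>V = W'\<close>; its imaginary part is \<open>- 2 W\<close>. It is
  obtained by solving \<open>k X' + l Y' = 2 \<bar>\<kappa>\<bar>\<^sup>2 W\<close> and \<open>Y X' + X Y' = V\<close>. The control is its sum with
  the real part of \<open>x\<^sup>2\<close>.
\<close>
definition flat_drift :: "real \<Rightarrow> real \<Rightarrow> real \<Rightarrow> real \<Rightarrow> real \<Rightarrow> real \<Rightarrow> real" where
  "flat_drift \<sigma> k l Q W V =
     (V - 2 * W * (k * flat_im \<sigma> k l Q W + l * flat_re \<sigma> k l Q W)) /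
     (k * flat_re \<sigma> k l Q W - l * flat_im \<sigma> k l Q W)"

definition flat_control :: "real \<Rightarrow> real \<Rightarrow> real \<Rightarrow> real \<Rightarrow> real \<Rightarrow> real \<Rightarrow> real" where
  "flat_control \<sigma> k l Q W V =
     flat_drift \<sigma> k l Q W V + (flat_re \<sigma> k l Q W)\<^sup>2 - (flat_im \<sigma> k l Q W)\<^sup>2"

definition flat_regular :: "real \<Rightarrow> real \<Rightarrow> real \<Rightarrow> real \<Rightarrow> real \<Rightarrow> bool" where
  "flat_regular \<sigma> k l Q W \<longleftrightarrow> k \<noteq> 0 \<and> Q\<^sup>2 - 4 * k * l * W > 0 \<and> flat_re \<sigma> k l Q W \<noteq> 0"

lemma flat_identities:
  assumes "flat_regular \<sigma> k l Q W" "\<sigma>\<^sup>2 = 1"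
  defines "X \<equiv> flat_re \<sigma> k l Q W" and "Y \<equiv> flat_im \<sigma> k l Q W"
  shows "X * Y = W" "k * X + l * Y = Q" "k * X - l * Y = \<sigma> * sqrt (Q\<^sup>2 - 4 * k * l * W)"
    "k * X - l * Y \<noteq> 0"
proof -
  define S where "S = sqrt (Q\<^sup>2 - 4 * k * l * W)"
  have k: "k \<noteq> 0" and D: "Q\<^sup>2 - 4 * k * l * W > 0" and X0: "X \<noteq> 0"
    using assms unfolding flat_regular_def by auto
  have S2: "S\<^sup>2 = Q\<^sup>2 - 4 * k * l * W" and S0: "S > 0" using D unfolding S_def by auto
  have s0: "\<sigma> \<noteq> 0" using assms(2) by auto
  show XY: "X * Y = W" using X0 unfolding Y_def X_def flat_im_def by simp
  have X2: "2 * k * X = Q + \<sigma> * S" unfolding X_def flat_re_def S_def using k by simp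
  have "4 * k * (k * X\<^sup>2 - Q * X + l * W) = (2*k*X)\<^sup>2 - 2 * Q * (2*k*X) + 4*k*l*W" 
    by (simp add: power2_eq_square algebra_simps)
  also have "\<dots> = \<sigma>\<^sup>2 * S\<^sup>2 - Q\<^sup>2 + 4*k*l*W"
    unfolding X2 by (simp add: power2_eq_square algebra_simps)
  also have "\<dots> = 0" using S2 assms(2) by simp
  finally have "k * X\<^sup>2 - Q * X + l * W = 0" using k by simp
  then have "X * (k * X + l * Y - Q) = 0"
    unfolding XY [symmetric] by (simp add: power2_eq_square algebra_simps)
  then show *: "k * X + l * Y = Q" using X0 by simp
  show "k * X - l * Y = \<sigma> * sqrt (Q\<^sup>2 - 4 * k * l * W)"
    using * X2 unfolding S_def by linarith
  then show "k * X - l * Y \<noteq> 0" using s0 S0 unfolding S_def by simp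
qed

text \<open>
  The discriminant of the quadratic equation is \<open>(k X - l Y)\<^sup>2\<close>, so that a state on the branch \<open>\<sigma>\<close> is
  recovered from its flat coordinates.
\<close>
lemma flat_re_eq:
  assumes "k \<noteq> 0" "\<sigma>\<^sup>2 = 1" "\<sigma> * (k * X - l * Y) > 0"
  shows "flat_re \<sigma> k l (k * X + l * Y) (X * Y) = X"
proof -
  have "(k * X + l * Y)\<^sup>2 - 4 * k * l * (X * Y) = (\<sigma> * (k * X - l * Y))\<^sup>2"
    using assms(2) by (simp add: power_mult_distrib) (simp add: power2_eq_square algebra_simps)
  then have "sqrt ((k * X + l * Y)\<^sup>2 - 4 * k * l * (X * Y)) = \<sigma> * (k * X - l * Y)"
    using assms(3) by simp
  moreover have "\<sigma> * (\<sigma> * (k * X - l * Y)) = k * X - l * Y"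
    using assms(2) by (metis mult.assoc mult_1 power2_eq_square)
  ultimately have "flat_re \<sigma> k l (k * X + l * Y) (X * Y) = (k * X + l * Y + (k * X - l * Y)) / (2 * k)"
    unfolding flat_re_def by metis
  then show ?thesis using assms(1) by simp
qed

text \<open>
  The two derivatives together say \<open>x' = \<i> \<kappa> (G - 2 \<i> W)\<close> for \<open>x = X + \<i> Y\<close>. As \<open>2 W\<close> is the imaginary part
  of \<open>x\<^sup>2\<close>, this is \<open>x' = \<i> \<kappa> (\<epsilon> - x\<^sup>2)\<close> with the real control \<open>\<epsilon> = G + Re (x\<^sup>2)\<close>: every regular \<open>Q\<close>
  is the output of a trajectory.
\<close>
lemma flat_derivatives:
  fixes Q W :: "real \<Rightarrow> real"
  assumes reg: "flat_regular \<sigma> k l (Q s) (W s)" and \<sigma>: "\<sigma>\<^sup>2 = 1"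
    and dQ: "(Q has_real_derivative 2 * (k\<^sup>2 + l\<^sup>2) * W s) (at s)"
    and dW: "(W has_real_derivative V) (at s)"
  defines "G \<equiv> flat_drift \<sigma> k l (Q s) (W s) V"
  shows "((\<lambda>s. flat_re \<sigma> k l (Q s) (W s)) has_real_derivative 2 * k * W s - l * G) (at s)"
    and "((\<lambda>s. flat_im \<sigma> k l (Q s) (W s)) has_real_derivative k * G + 2 * l * W s) (at s)"
proof -
  define X where "X = flat_re \<sigma> k l (Q s) (W s)"
  define Y where "Y = flat_im \<sigma> k l (Q s) (W s)"
  define N where "N = k * X - l * Y"
  define Qd where "Qd = 2 * (k\<^sup>2 + l\<^sup>2) * W s"
  note id = flat_identities [OF reg \<sigma>, folded X_def Y_def]
  have k: "k \<noteq> 0" and D: "(Q s)\<^sup>2 - 4 * k * l * W s > 0" and X0: "X \<noteq> 0"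
    using reg unfolding flat_regular_def X_def by auto
  have N0: "N \<noteq> 0" using id(4) unfolding N_def .
  have G: "G * N = V - 2 * W s * (k * Y + l * X)"
    using N0 unfolding G_def flat_drift_def X_def Y_def N_def by simp
  define S where "S = sqrt ((Q s)\<^sup>2 - 4 * k * l * W s)"
  have S0: "S > 0" using D unfolding S_def by simp
  have NS: "N = \<sigma> * S" using id(3) unfolding N_def S_def .
  have "((\<lambda>s. flat_re \<sigma> k l (Q s) (W s)) has_real_derivative
      (Qd + \<sigma> * ((2 * Q s * Qd - 4 * k * l * V) * (inverse S / 2))) / (2 * k)) (at s)"
    unfolding flat_re_def S_def Qd_def
    by (rule DERIV_cdivide derivative_eq_intros dQ dW refl | use D k in \<open>simp; fail\<close>)+
  moreover have "(Qd + \<sigma> * ((2 * Q s * Qd - 4 * k * l * V) * (inverse S / 2))) / (2 * k)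
      = 2 * k * W s - l * G"
  proof -
    have "\<sigma> * (inverse S / 2) = 1 / (2 * N)"
    proof -
      have "\<sigma> \<noteq> 0" using \<sigma> by auto
      then have "\<sigma> * (inverse S / 2) = \<sigma>\<^sup>2 / (2 * (\<sigma> * S))"
        using S0 by (simp add: divide_simps power2_eq_square)
      then show ?thesis unfolding NS \<sigma> .
    qed
    then have "\<sigma> * ((2 * Q s * Qd - 4 * k * l * V) * (inverse S / 2))
        = (2 * Q s * Qd - 4 * k * l * V) * (1 / (2 * N))"
      by (metis mult.left_commute)
    then have e1: "N * (Qd + \<sigma> * ((2 * Q s * Qd - 4 * k * l * V) * (inverse S / 2)))
        = N * Qd + (Q s * Qd - 2 * k * l * V)"
      using N0 by (simp add: distrib_left diff_divide_distrib right_diff_distrib)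
    have "N * (2 * k * (2 * k * W s - l * G)) = 2 * k * (2 * k * W s * N - l * (G * N))"
      by (simp add: algebra_simps)
    also have "\<dots> = 2 * k * (2 * k * W s * (k * X - l * Y) - l * (V - 2 * W s * (k * Y + l * X)))"
      unfolding G by (simp add: N_def)
    also have "\<dots> = N * Qd + (Q s * Qd - 2 * k * l * V)"
      unfolding N_def Qd_def id(2) [symmetric] by (simp add: power2_eq_square algebra_simps)
    finally have "N * (2 * k * (2 * k * W s - l * G)) =
       N * (Qd + \<sigma> * ((2 * Q s * Qd - 4 * k * l * V) * (inverse S / 2)))" using e1 by simp
    then have "2 * k * (2 * k * W s - l * G) =
       Qd + \<sigma> * ((2 * Q s * Qd - 4 * k * l * V) * (inverse S / 2))"
      using N0 mult_left_cancel by blast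
    then show ?thesis using k by (metis mult_eq_0_iff nonzero_mult_div_cancel_left zero_neq_numeral)
  qed
  ultimately show dX: "((\<lambda>s. flat_re \<sigma> k l (Q s) (W s)) has_real_derivative 2 * k * W s - l * G) (at s)"
    by simp
  have "((\<lambda>s. flat_im \<sigma> k l (Q s) (W s)) has_real_derivative
      (V * X - W s * (2 * k * W s - l * G)) / (X * X)) (at s)"
    unfolding flat_im_def X_def
    by (rule DERIV_divide [OF dW dX]) (use X0 X_def in simp)
  moreover have "(V * X - W s * (2 * k * W s - l * G)) / (X * X) = k * G + 2 * l * W s"
  proof -
    have V: "V = G * N + 2 * W s * (k * Y + l * X)" using G by simp
    have "(G * N + 2 * W s * (k * Y + l * X)) * X - W s * (2 * k * W s - l * G) = (k * G + 2 * l * W s) * (X * X)"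
      unfolding N_def id(1) [symmetric] by (simp add: algebra_simps)
    then have "V * X - W s * (2 * k * W s - l * G) = (k * G + 2 * l * W s) * (X * X)"
      using V by metis
    then show ?thesis using X0 by simp
  qed
  ultimately show "((\<lambda>s. flat_im \<sigma> k l (Q s) (W s)) has_real_derivative k * G + 2 * l * W s) (at s)"
    by simp
qed

text \<open>
  Uniformity in \<open>\<kappa>\<close> comes from here: the inversion and the control are continuous in
  \<open>(\<kappa>, Q - k \<eta>, W, V)\<close> at \<open>(\<kappa>\<^sub>0, 0, 0, 0)\<close>, where the control has the value \<open>\<eta>\<^sup>2\<close>. Measuring \<open>Q\<close> from the
  \<open>\<kappa>\<close>-dependent value \<open>k \<eta>\<close> keeps the equilibrium at the origin for every \<open>\<kappa>\<close>.
\<close>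
lemma flat_near_equilibrium:
  fixes \<kappa>\<^sub>0 :: complex and \<eta> :: real
  assumes "Re \<kappa>\<^sub>0 \<noteq> 0" "\<eta> \<noteq> 0" "lo < \<eta>\<^sup>2" "\<eta>\<^sup>2 < hi"
  defines "\<sigma> \<equiv> sgn (Re \<kappa>\<^sub>0 * \<eta>)"
  obtains e where "e > 0" 
   "\<And>\<kappa> q W V. \<lbrakk>dist \<kappa> \<kappa>\<^sub>0 < e; \<bar>q\<bar> < e; \<bar>W\<bar> < e; \<bar>V\<bar> < e\<rbrakk> \<Longrightarrow>
      flat_regular \<sigma> (Re \<kappa>) (Im \<kappa>) (Re \<kappa> * \<eta> + q) W \<and>
      lo < flat_control \<sigma> (Re \<kappa>) (Im \<kappa>) (Re \<kappa> * \<eta> + q) W V \<and>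
      flat_control \<sigma> (Re \<kappa>) (Im \<kappa>) (Re \<kappa> * \<eta> + q) W V < hi"
   "\<And>\<kappa> x. \<lbrakk>dist \<kappa> \<kappa>\<^sub>0 < e; dist x (complex_of_real \<eta>) < e\<rbrakk> \<Longrightarrow>
      Re \<kappa> \<noteq> 0 \<and> \<sigma> * (Re \<kappa> * Re x - Im \<kappa> * Im x) > 0"
proof -
  define F where "F = nhds (\<kappa>\<^sub>0, 0::real, 0::real, 0::real)"
  define kk where "kk = (\<lambda>p::complex \<times> real \<times> real \<times> real. Re (fst p))"
  define ll where "ll = (\<lambda>p::complex \<times> real \<times> real \<times> real. Im (fst p))"
  define QQ where "QQ = (\<lambda>p::complex \<times> real \<times> real \<times> real. Re (fst p) * \<eta> + fst (snd p))"
  define WW where "WW = (\<lambda>p::complex \<times> real \<times> real \<times> real. fst (snd (snd p)))"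
  define VV where "VV = (\<lambda>p::complex \<times> real \<times> real \<times> real. snd (snd (snd p)))"
  let ?k = "Re \<kappa>\<^sub>0" and ?l = "Im \<kappa>\<^sub>0"
  have \<sigma>: "\<sigma> * \<bar>?k * \<eta>\<bar> = ?k * \<eta>" unfolding \<sigma>_def by (simp add: sgn_mult_abs abs_sgn_eq sgn_if)
  have lim: "filterlim (\<lambda>p. p) (nhds (\<kappa>\<^sub>0, 0::real, 0::real, 0::real)) F"
    unfolding F_def by (rule filterlim_ident)
  have t1: "(kk \<longlongrightarrow> ?k) F" "(ll \<longlongrightarrow> ?l) F" "(WW \<longlongrightarrow> 0) F" "(VV \<longlongrightarrow> 0) F"
    "(QQ \<longlongrightarrow> ?k * \<eta>) F"
    unfolding kk_def ll_def WW_def VV_def QQ_def by (rule tendsto_eq_intros lim refl | simp)+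
  have tX: "((\<lambda>p. flat_re \<sigma> (kk p) (ll p) (QQ p) (WW p)) \<longlongrightarrow> \<eta>) F"
    unfolding flat_re_def
    by (rule tendsto_eq_intros t1 refl | use assms \<sigma> in \<open>simp add: \<sigma> power2_eq_square[symmetric] del: mult_eq_0_iff; fail\<close>)+
  have tY: "((\<lambda>p. flat_im \<sigma> (kk p) (ll p) (QQ p) (WW p)) \<longlongrightarrow> 0) F"
    unfolding flat_im_def
    by (rule tendsto_eq_intros t1 tX refl | use assms in \<open>simp; fail\<close>)+
  have tG: "((\<lambda>p. flat_drift \<sigma> (kk p) (ll p) (QQ p) (WW p) (VV p)) \<longlongrightarrow> 0) F"
    unfolding flat_drift_def
    by (rule tendsto_eq_intros t1 tX tY refl | use assms in \<open>simp; fail\<close>)+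
  have tE: "((\<lambda>p. flat_control \<sigma> (kk p) (ll p) (QQ p) (WW p) (VV p)) \<longlongrightarrow> \<eta>\<^sup>2) F"
    unfolding flat_control_def
    by (rule tendsto_eq_intros tG tX tY refl | use assms in \<open>simp; fail\<close>)+
  have tD: "((\<lambda>p. (QQ p)\<^sup>2 - 4 * kk p * ll p * WW p) \<longlongrightarrow> (?k * \<eta>)\<^sup>2) F"
    by (rule tendsto_eq_intros t1 refl | simp)+
  have kn: "(?k * \<eta>)\<^sup>2 > 0" using assms by simp
  have "\<forall>\<^sub>F p in F. (kk p \<noteq> 0 \<and> (QQ p)\<^sup>2 - 4 * kk p * ll p * WW p > 0
      \<and> flat_re \<sigma> (kk p) (ll p) (QQ p) (WW p) \<noteq> 0)
      \<and> lo < flat_control \<sigma> (kk p) (ll p) (QQ p) (WW p) (VV p)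
      \<and> flat_control \<sigma> (kk p) (ll p) (QQ p) (WW p) (VV p) < hi"
    using tendsto_imp_eventually_ne [OF t1(1) assms(1)] order_tendstoD(1) [OF tD kn]
      tendsto_imp_eventually_ne [OF tX assms(2)] order_tendstoD(1) [OF tE assms(3)]
      order_tendstoD(2) [OF tE assms(4)]
    by eventually_elim auto
  then obtain d where d: "d > 0" and dd: "\<And>p. dist p (\<kappa>\<^sub>0, 0, 0, 0) < d \<Longrightarrow>
      flat_regular \<sigma> (kk p) (ll p) (QQ p) (WW p)
      \<and> lo < flat_control \<sigma> (kk p) (ll p) (QQ p) (WW p) (VV p)
      \<and> flat_control \<sigma> (kk p) (ll p) (QQ p) (WW p) (VV p) < hi"
    unfolding F_def eventually_nhds_metric flat_regular_def by blast
  define F2 where "F2 = nhds (\<kappa>\<^sub>0, complex_of_real \<eta>)"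
  have lim2: "filterlim (\<lambda>p. p) (nhds (\<kappa>\<^sub>0, complex_of_real \<eta>)) F2"
    unfolding F2_def by (rule filterlim_ident)
  have u1: "((\<lambda>p. Re (fst p)) \<longlongrightarrow> ?k) F2"
    by (rule tendsto_eq_intros lim2 refl | simp)+
  have u2: "((\<lambda>p. \<sigma> * (Re (fst p) * Re (snd p) - Im (fst p) * Im (snd p))) \<longlongrightarrow> \<sigma> * (?k * \<eta>)) F2"
    by (rule tendsto_eq_intros lim2 refl | simp)+
  have "\<sigma> * (?k * \<eta>) > 0"
    using assms unfolding \<sigma>_def by (metis abs_sgn mult.commute mult_eq_0_iff zero_less_abs_iff)
  then have "\<forall>\<^sub>F p in F2. Re (fst p) \<noteq> 0 \<and> \<sigma> * (Re (fst p) * Re (snd p) - Im (fst p) * Im (snd p)) > 0"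
    using tendsto_imp_eventually_ne [OF u1 assms(1)] order_tendstoD(1) [OF u2]
    by (intro eventually_conj) auto
  then obtain d2 where d2: "d2 > 0" and dd2: "\<And>p. dist p (\<kappa>\<^sub>0, complex_of_real \<eta>) < d2 \<Longrightarrow>
      Re (fst p) \<noteq> 0 \<and> \<sigma> * (Re (fst p) * Re (snd p) - Im (fst p) * Im (snd p)) > 0"
    unfolding F2_def eventually_nhds_metric by blast
  have pair: "dist (a, b) (c, d) \<le> dist a c + dist b d"
    for a c :: "'x::metric_space" and b d :: "'y::metric_space"
    unfolding dist_Pair_Pair by (rule sqrt_sum_squares_le_sum) auto
  show thesis
  proof
    show "min (d / 4) (d2 / 2) > 0" using d d2 by simp
  next
    fix \<kappa> :: complex and q W V :: real
    assume a: "dist \<kappa> \<kappa>\<^sub>0 < min (d / 4) (d2 / 2)" "\<bar>q\<bar> < min (d / 4) (d2 / 2)"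
      "\<bar>W\<bar> < min (d / 4) (d2 / 2)" "\<bar>V\<bar> < min (d / 4) (d2 / 2)"
    have "dist (\<kappa>, q, W, V) (\<kappa>\<^sub>0, 0, 0, 0) \<le> dist \<kappa> \<kappa>\<^sub>0 + (dist q 0 + (dist W 0 + dist V 0))"
      by (intro order_trans [OF pair] add_left_mono) simp
    also have "\<dots> < d" using a by (simp add: dist_real_def)
    finally show "flat_regular \<sigma> (Re \<kappa>) (Im \<kappa>) (Re \<kappa> * \<eta> + q) W \<and>
      lo < flat_control \<sigma> (Re \<kappa>) (Im \<kappa>) (Re \<kappa> * \<eta> + q) W V \<and>
      flat_control \<sigma> (Re \<kappa>) (Im \<kappa>) (Re \<kappa> * \<eta> + q) W V < hi"
      using dd [of "(\<kappa>, q, W, V)"] unfolding kk_def ll_def QQ_def WW_def VV_def by simp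
  next
    fix \<kappa> x :: complex
    assume a: "dist \<kappa> \<kappa>\<^sub>0 < min (d / 4) (d2 / 2)" "dist x (complex_of_real \<eta>) < min (d / 4) (d2 / 2)"
    have "dist (\<kappa>, x) (\<kappa>\<^sub>0, complex_of_real \<eta>) < d2"
      using pair [of \<kappa> x \<kappa>\<^sub>0 "complex_of_real \<eta>"] a by simp
    then show "Re \<kappa> \<noteq> 0 \<and> \<sigma> * (Re \<kappa> * Re x - Im \<kappa> * Im x) > 0" using dd2 [of "(\<kappa>, x)"] by simp
  qed
qed


text \<open>
  The control is frozen at its end values outside the time interval, which makes it continuous on
  the whole line and feasible for all times.
\<close>
lemma steers_flat:
  fixes Q W V :: "real \<Rightarrow> real"
  assumes T: "0 < T" and \<sigma>: "\<sigma>\<^sup>2 = 1"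
    and dQ: "\<And>s. (Q has_real_derivative 2 * ((Re \<kappa>)\<^sup>2 + (Im \<kappa>)\<^sup>2) * W s) (at s)"
    and dW: "\<And>s. (W has_real_derivative V s) (at s)"
    and V: "continuous_on UNIV V"
    and reg: "\<And>s. s \<in> {s\<^sub>0..s\<^sub>0 + T} \<Longrightarrow> flat_regular \<sigma> (Re \<kappa>) (Im \<kappa>) (Q s) (W s)"
    and lo: "\<And>s. s \<in> {s\<^sub>0..s\<^sub>0 + T} \<Longrightarrow> n\<^sub>1\<^sup>2 \<le> flat_control \<sigma> (Re \<kappa>) (Im \<kappa>) (Q s) (W s) (V s)"
    and hi: "\<And>s. s \<in> {s\<^sub>0..s\<^sub>0 + T} \<Longrightarrow> flat_control \<sigma> (Re \<kappa>) (Im \<kappa>) (Q s) (W s) (V s) \<le> n\<^sub>2\<^sup>2"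
  defines "z \<equiv> \<lambda>s. Complex (flat_re \<sigma> (Re \<kappa>) (Im \<kappa>) (Q s) (W s)) (flat_im \<sigma> (Re \<kappa>) (Im \<kappa>) (Q s) (W s))"
  shows "steers n\<^sub>1 n\<^sub>2 s\<^sub>0 \<kappa> T (fin (z s\<^sub>0)) (fin (z (s\<^sub>0 + T)))"
proof -
  define I where "I = {s\<^sub>0..s\<^sub>0 + T}"
  let ?X = "\<lambda>s. flat_re \<sigma> (Re \<kappa>) (Im \<kappa>) (Q s) (W s)" and ?Y = "\<lambda>s. flat_im \<sigma> (Re \<kappa>) (Im \<kappa>) (Q s) (W s)"
  let ?G = "\<lambda>s. flat_drift \<sigma> (Re \<kappa>) (Im \<kappa>) (Q s) (W s) (V s)"
  define E where "E = (\<lambda>s. flat_control \<sigma> (Re \<kappa>) (Im \<kappa>) (Q s) (W s) (V s))"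
  define \<epsilon> where "\<epsilon> = (\<lambda>s. E (max s\<^sub>0 (min s (s\<^sub>0 + T))))"
  have \<epsilon>I: "\<epsilon> s = E s" if "s \<in> I" for s using that unfolding \<epsilon>_def I_def by (simp add: min_def max_def)
  have clampI: "max s\<^sub>0 (min s (s\<^sub>0 + T)) \<in> {s\<^sub>0..s\<^sub>0 + T}" for s using T by auto
  have cQ: "continuous_on A Q" and cW: "continuous_on A W" for A
    using dQ dW by (meson DERIV_isCont continuous_at_imp_continuous_on)+
  have dX: "(?X has_real_derivative 2 * Re \<kappa> * W s - Im \<kappa> * ?G s) (at s)"
    and dY: "(?Y has_real_derivative Re \<kappa> * ?G s + 2 * Im \<kappa> * W s) (at s)" if "s \<in> I" for s
    using flat_derivatives [OF reg \<sigma> dQ dW] that unfolding I_def by auto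
  have cX: "continuous_on I ?X" and cY: "continuous_on I ?Y"
    using dX dY by (meson DERIV_isCont continuous_at_imp_continuous_on)+
  have cG: "continuous_on I ?G"
    unfolding flat_drift_def
    by (intro continuous_intros cX cY cW continuous_on_subset [OF V])
       (use flat_identities(4) [OF reg \<sigma>] I_def in auto)
  have cE: "continuous_on I E"
    unfolding E_def flat_control_def by (intro continuous_intros cX cY cG)
  have c\<epsilon>: "continuous_on UNIV \<epsilon>"
    unfolding \<epsilon>_def
    by (rule continuous_on_compose2 [OF cE]) (use clampI I_def in \<open>auto intro!: continuous_intros\<close>)
  have feas: "feasible n\<^sub>1 n\<^sub>2 s\<^sub>0 \<epsilon>"
    unfolding feasible_def
  proof
    show "\<epsilon> \<in> borel_measurable (lebesgue_on {s\<^sub>0<..})"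
      using c\<epsilon> by (intro continuous_imp_measurable_on_sets_lebesgue continuous_on_subset [OF c\<epsilon>]) auto
    show "AE s in lebesgue_on {s\<^sub>0<..}. n\<^sub>1\<^sup>2 \<le> \<epsilon> s \<and> \<epsilon> s \<le> n\<^sub>2\<^sup>2"
      using lo [OF clampI] hi [OF clampI] unfolding \<epsilon>_def E_def by simp
  qed
  have alg: "complex_of_real (2 * Re \<kappa> * w - Im \<kappa> * g) + \<i> * complex_of_real (Re \<kappa> * g + 2 * Im \<kappa> * w)
      = \<i> * \<kappa> * (- (Complex a b)\<^sup>2 + complex_of_real (g + a\<^sup>2 - b\<^sup>2))" if "a * b = w" for a b g w
    unfolding that [symmetric] by (simp add: complex_eq_iff power2_eq_square algebra_simps)
  have dz: "(z has_vector_derivative \<i> * \<kappa> * (- (z s)\<^sup>2 + complex_of_real (\<epsilon> s))) (at s)"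
    if s: "s \<in> I" for s
  proof -
    have XY: "?X s * ?Y s = W s"
      using flat_identities(1) [OF reg \<sigma>] s unfolding I_def by auto
    have "((\<lambda>s. complex_of_real (?X s) + \<i> * complex_of_real (?Y s)) has_vector_derivative
        (complex_of_real (2 * Re \<kappa> * W s - Im \<kappa> * ?G s) + \<i> * complex_of_real (Re \<kappa> * ?G s + 2 * Im \<kappa> * W s))) (at s)"
      using dX [OF s] dY [OF s]
      by (intro has_vector_derivative_add has_vector_derivative_mult_right has_vector_derivative_of_real)
        (simp_all add: has_real_derivative_iff_has_vector_derivative)
    moreover have "complex_of_real (2 * Re \<kappa> * W s - Im \<kappa> * ?G s) + \<i> * complex_of_real (Re \<kappa> * ?G s + 2 * Im \<kappa> * W s)
        = \<i> * \<kappa> * (- (z s)\<^sup>2 + complex_of_real (\<epsilon> s))"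
      unfolding \<epsilon>I [OF s] E_def flat_control_def z_def by (rule alg [OF XY])
    moreover have "z = (\<lambda>s. complex_of_real (?X s) + \<i> * complex_of_real (?Y s))"
      unfolding z_def by (simp add: Complex_eq)
    ultimately show ?thesis by simp
  qed
  have cz: "continuous_on I z"
    using dz by (meson continuous_at_imp_continuous_on has_vector_derivative_continuous)
  have car: "caratheodory_solution J (\<lambda>u z. \<i> * \<kappa> * (- z\<^sup>2 + complex_of_real (\<epsilon> u))) z" if "J \<subseteq> I" for J
    unfolding caratheodory_solution_def
  proof (intro ballI impI conjI)
    fix a b assume ab: "a \<in> J" "b \<in> J" "a \<le> b"
    have sub: "{a..b} \<subseteq> I" using ab that unfolding I_def by fastforce
    show "(\<lambda>s. \<i> * \<kappa> * (- (z s)\<^sup>2 + complex_of_real (\<epsilon> s))) absolutely_integrable_on {a..b}"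
      by (intro absolutely_integrable_continuous_real continuous_intros
          continuous_on_subset [OF cz sub] continuous_on_subset [OF c\<epsilon>]) auto
    have "((\<lambda>s. \<i> * \<kappa> * (- (z s)\<^sup>2 + complex_of_real (\<epsilon> s))) has_integral z b - z a) {a..b}"
      by (rule fundamental_theorem_of_calculus [OF ab(3)])
        (use dz sub in \<open>blast intro: has_vector_derivative_at_within\<close>)
    then show "z b - z a = integral {a..b} (\<lambda>s. \<i> * \<kappa> * (- (z s)\<^sup>2 + complex_of_real (\<epsilon> s)))"
      by (rule integral_unique [symmetric])
  qed
  have "trajectory \<kappa> \<epsilon> s\<^sub>0 (s\<^sub>0 + T) (\<lambda>s. fin (z s))"
    unfolding trajectory_def Let_def
    by (intro ballI exI [of _ 1] conjI disjI1) (use car I_def in auto)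
  then show ?thesis unfolding steers_def using feas by auto
qed

text \<open>
  The cubic \<open>Q\<close> with prescribed values and slopes at the ends of an interval of length \<open>T\<close>, written
  through its derivative: \<open>W\<close> is linear interpolation plus a multiple \<open>c\<close> of the bump
  \<open>6 \<tau> (1 - \<tau>)\<close>, which has integral one and so adjusts the increment of \<open>Q\<close>. Data of size
  \<open>C T\<^sup>2\<close> make \<open>c\<close> of size \<open>C T\<close> and \<open>V = W'\<close> of size \<open>C\<close>.
\<close>
lemma flat_interpolation:
  fixes Qa Qb Wa Wb \<mu> T C :: real
  assumes T: "0 < T" "T \<le> 1" and \<mu>: "0 < \<mu>" and C: "C \<ge> 0"
    and W: "\<bar>Wa\<bar> \<le> C * T\<^sup>2" "\<bar>Wb\<bar> \<le> C * T\<^sup>2" and Q: "\<bar>Qb - Qa\<bar> \<le> C * T\<^sup>2"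
  obtains Q W V :: "real \<Rightarrow> real" where
    "\<And>s. (Q has_real_derivative \<mu> * W s) (at s)" "\<And>s. (W has_real_derivative V s) (at s)"
    "continuous_on UNIV V" "Q s\<^sub>0 = Qa" "Q (s\<^sub>0 + T) = Qb" "W s\<^sub>0 = Wa" "W (s\<^sub>0 + T) = Wb"
    "\<And>s. s \<in> {s\<^sub>0..s\<^sub>0 + T} \<Longrightarrow> \<bar>Q s - Qa\<bar> \<le> (3 * \<mu> + 1) * C"
    "\<And>s. s \<in> {s\<^sub>0..s\<^sub>0 + T} \<Longrightarrow> \<bar>W s\<bar> \<le> (8 + 6 / \<mu>) * C"
    "\<And>s. s \<in> {s\<^sub>0..s\<^sub>0 + T} \<Longrightarrow> \<bar>V s\<bar> \<le> (8 + 6 / \<mu>) * C"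
proof -
  define c where "c = (Qb - Qa) / (\<mu> * T) - (Wa + Wb) / 2"
  define \<tau> where "\<tau> = (\<lambda>s. (s - s\<^sub>0) / T)"
  define W where "W = (\<lambda>s. Wa * (1 - \<tau> s) + Wb * \<tau> s + 6 * c * (\<tau> s * (1 - \<tau> s)))"
  define Q where "Q = (\<lambda>s. Qa + \<mu> * T * (Wa * (\<tau> s - (\<tau> s)\<^sup>2 / 2) + Wb * ((\<tau> s)\<^sup>2 / 2) + c * (3 * (\<tau> s)\<^sup>2 - 2 * (\<tau> s)^3)))"
  define V where "V = (\<lambda>s. (Wb - Wa + 6 * c * (1 - 2 * \<tau> s)) / T)"
  have d\<tau>: "(\<tau> has_real_derivative 1 / T) (at s)" for s
    unfolding \<tau>_def using T by (auto intro!: derivative_eq_intros)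
  have dP: "((\<lambda>t. Wa * (t - t\<^sup>2 / 2) + Wb * (t\<^sup>2 / 2) + c * (3 * t\<^sup>2 - 2 * t^3)) has_real_derivative
      Wa * (1 - t) + Wb * t + 6 * c * (t * (1 - t))) (at t)" for t
    by (rule DERIV_cdivide derivative_eq_intros refl)+ (simp add: power2_eq_square algebra_simps)
  have dQ: "(Q has_real_derivative \<mu> * W s) (at s)" for s
    using DERIV_add [OF DERIV_const DERIV_cmult [OF DERIV_chain2 [OF dP d\<tau>], of "\<mu> * T"], of Qa s] T
    unfolding Q_def W_def by simp
  have dR: "((\<lambda>t. Wa * (1 - t) + Wb * t + 6 * c * (t * (1 - t))) has_real_derivative
      Wb - Wa + 6 * c * (1 - 2 * t)) (at t)" for t
    by (rule derivative_eq_intros refl)+ (simp add: algebra_simps)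
  have dW: "(W has_real_derivative V s) (at s)" for s
    using DERIV_chain2 [OF dR d\<tau>, of s] unfolding W_def V_def by simp
  have cV: "continuous_on UNIV V"
    unfolding V_def \<tau>_def using T by (intro continuous_intros) auto
  have \<tau>01: "\<tau> s\<^sub>0 = 0" "\<tau> (s\<^sub>0 + T) = 1" unfolding \<tau>_def using T by auto
  have \<tau>I: "0 \<le> \<tau> s \<and> \<tau> s \<le> 1" if "s \<in> {s\<^sub>0..s\<^sub>0 + T}" for s
    using that T unfolding \<tau>_def by (auto simp: field_simps)
  have "\<bar>(Qb - Qa) / (\<mu> * T)\<bar> \<le> C * T\<^sup>2 / (\<mu> * T)"
    using Q \<mu> T unfolding abs_divide by (intro frac_le) auto
  also have "\<dots> = C / \<mu> * T" using T \<mu> by (simp add: power2_eq_square)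
  finally have cb1: "\<bar>(Qb - Qa) / (\<mu> * T)\<bar> \<le> C / \<mu> * T" .
  have TT: "C * T\<^sup>2 \<le> C * T" using T C by (simp add: power2_eq_square mult_left_le mult_left_mono)
  have TC: "C * T \<le> C" using T C by (simp add: mult_left_le)
  have cb: "\<bar>c\<bar> \<le> (1 + 1 / \<mu>) * C * T"
  proof -
    have "\<bar>(Wa + Wb) / 2\<bar> \<le> C * T" using W TT by (simp add: abs_le_iff)
    then have "\<bar>c\<bar> \<le> C / \<mu> * T + C * T"
      unfolding c_def by (intro order_trans [OF abs_triangle_ineq4] add_mono cb1)
    then show ?thesis by (simp add: distrib_right)
  qed
  have ab: "\<bar>x * y\<bar> \<le> B" if "\<bar>x\<bar> \<le> B" "\<bar>y\<bar> \<le> 1" for x y B :: real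
    using mult_mono [OF that] that(1) by (simp add: abs_mult)
  have WT: "\<bar>Wa\<bar> \<le> C * T" "\<bar>Wb\<bar> \<le> C * T" using W TT by linarith+
  have sumb: "C * T + C * T + 6 * ((1 + 1 / \<mu>) * C * T) = (8 + 6 / \<mu>) * C * T"
    by (simp add: distrib_right distrib_left)
  have c1: "(8 + 6 / \<mu>) * C * T \<le> (8 + 6 / \<mu>) * C"
    using mult_left_mono [OF TC, of "8 + 6 / \<mu>"] \<mu> by (simp add: mult.assoc)
  show thesis
  proof (rule that [OF dQ dW cV])
    show "Q s\<^sub>0 = Qa" "W s\<^sub>0 = Wa" "W (s\<^sub>0 + T) = Wb" unfolding Q_def W_def \<tau>01 by simp_all
    show "Q (s\<^sub>0 + T) = Qb" 
    proof -
      have "Q (s\<^sub>0 + T) = Qa + \<mu> * T * ((Wa + Wb) / 2 + c)" unfolding Q_def \<tau>01 by simp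
      then show ?thesis using T \<mu> unfolding c_def by simp
    qed
  next
    fix s assume s: "s \<in> {s\<^sub>0..s\<^sub>0 + T}"
    note t = \<tau>I [OF s]
    have t2: "0 \<le> (\<tau> s)\<^sup>2" "(\<tau> s)\<^sup>2 \<le> \<tau> s" "0 \<le> (\<tau> s)^3" "(\<tau> s)^3 \<le> (\<tau> s)\<^sup>2"
      using t by (auto simp: power2_eq_square power3_eq_cube mult_left_le mult_left_le_one_le)
    have t3: "3 * (\<tau> s)\<^sup>2 - 2 * (\<tau> s)^3 \<le> 1"
    proof -
      have "0 \<le> (1 - \<tau> s)\<^sup>2 * (1 + 2 * \<tau> s)" using t by simp
      also have "\<dots> = 1 - (3 * (\<tau> s)\<^sup>2 - 2 * (\<tau> s)^3)"
        by (simp add: power2_eq_square power3_eq_cube algebra_simps)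
      finally show ?thesis by simp
    qed
    have "\<bar>Wa * (1 - \<tau> s)\<bar> \<le> C * T" "\<bar>Wb * \<tau> s\<bar> \<le> C * T"
      "\<bar>c * (\<tau> s * (1 - \<tau> s))\<bar> \<le> (1 + 1 / \<mu>) * C * T"
      using t by (intro ab WT cb; simp add: abs_mult mult_le_one)+
    then have "\<bar>W s\<bar> \<le> C * T + C * T + 6 * ((1 + 1 / \<mu>) * C * T)"
      unfolding W_def by linarith
    then show "\<bar>W s\<bar> \<le> (8 + 6 / \<mu>) * C" using sumb c1 by linarith
    have "\<bar>c * (1 - 2 * \<tau> s)\<bar> \<le> (1 + 1 / \<mu>) * C * T"
      using t by (intro ab cb) (simp add: abs_le_iff)
    then have "\<bar>Wb - Wa + 6 * c * (1 - 2 * \<tau> s)\<bar> \<le> (8 + 6 / \<mu>) * C * T"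
      using WT sumb by linarith
    then show "\<bar>V s\<bar> \<le> (8 + 6 / \<mu>) * C"
      unfolding V_def abs_divide using T by (simp add: pos_divide_le_eq)
    have "\<bar>Wa * (\<tau> s - (\<tau> s)\<^sup>2 / 2)\<bar> \<le> C * T" "\<bar>Wb * ((\<tau> s)\<^sup>2 / 2)\<bar> \<le> C * T"
      "\<bar>c * (3 * (\<tau> s)\<^sup>2 - 2 * (\<tau> s)^3)\<bar> \<le> (1 + 1 / \<mu>) * C * T"
      using t t2 t3 by (intro ab WT cb; linarith)+
    then have "\<bar>Wa * (\<tau> s - (\<tau> s)\<^sup>2 / 2) + Wb * ((\<tau> s)\<^sup>2 / 2) + c * (3 * (\<tau> s)\<^sup>2 - 2 * (\<tau> s)^3)\<bar>
        \<le> C * T + C * T + (1 + 1 / \<mu>) * C * T" by linarith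
    also have "\<dots> = (3 + 1 / \<mu>) * (C * T)" by (simp add: algebra_simps)
    also have "\<dots> \<le> (3 + 1 / \<mu>) * C" using TC \<mu> by (intro mult_left_mono) auto
    finally have *: "\<bar>Wa * (\<tau> s - (\<tau> s)\<^sup>2 / 2) + Wb * ((\<tau> s)\<^sup>2 / 2) + c * (3 * (\<tau> s)\<^sup>2 - 2 * (\<tau> s)^3)\<bar>
        \<le> (3 + 1 / \<mu>) * C" .
    have "\<bar>Q s - Qa\<bar> = \<mu> * (T * \<bar>Wa * (\<tau> s - (\<tau> s)\<^sup>2 / 2) + Wb * ((\<tau> s)\<^sup>2 / 2) + c * (3 * (\<tau> s)\<^sup>2 - 2 * (\<tau> s)^3)\<bar>)"
      unfolding Q_def using \<mu> T by (simp add: abs_mult)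
    also have "\<dots> \<le> \<mu> * (1 * ((3 + 1 / \<mu>) * C))"
      using * \<mu> T by (intro mult_left_mono mult_mono) auto
    also have "\<dots> = (3 * \<mu> + 1) * C" using \<mu> by (simp add: distrib_right distrib_left)
    finally show "\<bar>Q s - Qa\<bar> \<le> (3 * \<mu> + 1) * C" .
  qed
qed

text \<open>
  States within \<open>c T\<^sup>2\<close> of \<open>\<eta>\<close> have flat coordinates within \<open>O(c T\<^sup>2)\<close> of the equilibrium. For small \<open>c\<close>
  the interpolating curve therefore stays in the neighbourhood of \<open>flat_near_equilibrium\<close>, where the
  control is feasible. As both end points are arbitrary there, one statement serves for
  controllability to \<open>\<eta>\<close> and from \<open>\<eta>\<close>.
\<close>
lemma steers_near_equilibrium:
  fixes \<kappa>\<^sub>0 :: complex and \<eta> :: real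
  assumes k0: "Re \<kappa>\<^sub>0 \<noteq> 0" and \<eta>: "\<eta> \<noteq> 0" "n\<^sub>1\<^sup>2 < \<eta>\<^sup>2" "\<eta>\<^sup>2 < n\<^sub>2\<^sup>2"
  obtains \<delta> c where "\<delta> > 0" "c > 0"
    "\<And>\<kappa> T p q. \<lbrakk>\<kappa> \<in> ball \<kappa>\<^sub>0 \<delta>; 0 < T; T \<le> 1; p \<in> ball (complex_of_real \<eta>) (c * T\<^sup>2);
        q \<in> ball (complex_of_real \<eta>) (c * T\<^sup>2)\<rbrakk> \<Longrightarrow> steers n\<^sub>1 n\<^sub>2 s\<^sub>0 \<kappa> T (fin p) (fin q)"
proof -
  define \<sigma> where "\<sigma> = sgn (Re \<kappa>\<^sub>0 * \<eta>)"
  have \<sigma>: "\<sigma>\<^sup>2 = 1" using k0 \<eta> unfolding \<sigma>_def by (auto simp: sgn_if)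
  obtain e where e: "e > 0" and
    reg: "\<And>\<kappa> q W V. \<lbrakk>dist \<kappa> \<kappa>\<^sub>0 < e; \<bar>q\<bar> < e; \<bar>W\<bar> < e; \<bar>V\<bar> < e\<rbrakk> \<Longrightarrow>
      flat_regular \<sigma> (Re \<kappa>) (Im \<kappa>) (Re \<kappa> * \<eta> + q) W \<and>
      n\<^sub>1\<^sup>2 < flat_control \<sigma> (Re \<kappa>) (Im \<kappa>) (Re \<kappa> * \<eta> + q) W V \<and>
      flat_control \<sigma> (Re \<kappa>) (Im \<kappa>) (Re \<kappa> * \<eta> + q) W V < n\<^sub>2\<^sup>2" and
    pos: "\<And>\<kappa> x. \<lbrakk>dist \<kappa> \<kappa>\<^sub>0 < e; dist x (complex_of_real \<eta>) < e\<rbrakk> \<Longrightarrow>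
      Re \<kappa> \<noteq> 0 \<and> \<sigma> * (Re \<kappa> * Re x - Im \<kappa> * Im x) > 0"
    using flat_near_equilibrium [OF k0 \<eta>] unfolding \<sigma>_def by metis
  have n0: "norm \<kappa>\<^sub>0 > 0" using k0 by auto
  \<comment> \<open>\<open>m \<le> \<bar>\<kappa>\<bar> \<le> K\<close> on the disc of radius \<open>\<bar>\<kappa>\<^sub>0\<bar> / 2\<close>; with data of size \<open>B c T\<^sup>2\<close>, all flat
    coordinates of the curve are bounded by \<open>M c\<close>.\<close>
  define K where "K = 2 * norm \<kappa>\<^sub>0"
  define m where "m = norm \<kappa>\<^sub>0 / 2"
  define B where "B = \<bar>\<eta>\<bar> + 1 + 4 * K"
  define M where "M = 2 * K + (3 * (2 * K\<^sup>2) + 1) * B + (8 + 6 / (2 * m\<^sup>2)) * B"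
  define c where "c = min 1 (e / (2 * M + 1))"
  have m: "m > 0" and K: "K > 0" using n0 unfolding m_def K_def by auto
  have B1: "B \<ge> 1" using K unfolding B_def by simp
  have M1: "2 * K \<ge> 0" "(3 * (2 * K\<^sup>2) + 1) * B \<ge> 1" "(8 + 6 / (2 * m\<^sup>2)) * B \<ge> 8"
    using K B1 m mult_mono [of 1 "3 * (2 * K\<^sup>2) + 1" 1 B] mult_mono [of 8 "8 + 6 / (2 * m\<^sup>2)" 1 B]
    by auto
  have M: "M > 1" using M1 unfolding M_def by linarith
  have c: "c > 0" "c \<le> 1" using e M unfolding c_def by auto
  have "c \<le> e / (2 * M + 1)" unfolding c_def by simp
  then have "c * (2 * M + 1) \<le> e" using M by (simp add: pos_le_divide_eq)
  moreover have "c * M < c * (2 * M + 1)" using c M by simp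
  ultimately have cM: "c * M < e" by linarith
  have "c * 1 < c * M" using c M by (intro mult_strict_left_mono) auto
  then have "c < e" using cM by linarith
  show thesis
  proof (rule that [of "min e (norm \<kappa>\<^sub>0 / 2)" c])
    show "min e (norm \<kappa>\<^sub>0 / 2) > 0" using e n0 by simp
    show "c > 0" by (rule c)
  next
    fix \<kappa> T p q
    assume k: "\<kappa> \<in> ball \<kappa>\<^sub>0 (min e (norm \<kappa>\<^sub>0 / 2))" and T: "0 < T" "T \<le> 1"
      and p: "p \<in> ball (complex_of_real \<eta>) (c * T\<^sup>2)" and q: "q \<in> ball (complex_of_real \<eta>) (c * T\<^sup>2)"
    let ?k = "Re \<kappa>" and ?l = "Im \<kappa>"
    have ke: "dist \<kappa> \<kappa>\<^sub>0 < e" using k by (simp add: dist_commute)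
    have "dist \<kappa> \<kappa>\<^sub>0 < norm \<kappa>\<^sub>0 / 2" using k by (simp add: dist_commute)
    then have kK: "norm \<kappa> \<le> K" and km: "m \<le> norm \<kappa>"
      unfolding K_def m_def dist_norm using norm_triangle_ineq2 [of \<kappa> \<kappa>\<^sub>0] norm_triangle_ineq2 [of \<kappa>\<^sub>0 \<kappa>] n0
      by (auto simp: norm_minus_commute)
    define \<mu> where "\<mu> = 2 * ((Re \<kappa>)\<^sup>2 + (Im \<kappa>)\<^sup>2)"
    have \<mu>n: "\<mu> = 2 * (norm \<kappa>)\<^sup>2" unfolding \<mu>_def cmod_power2 ..
    have \<mu>K: "\<mu> \<le> 2 * K\<^sup>2" and \<mu>m: "2 * m\<^sup>2 \<le> \<mu>" unfolding \<mu>n using kK km m by (auto intro!: power_mono)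
    have m2: "2 * m\<^sup>2 > 0" using m by simp
    have \<mu>0: "\<mu> > 0" using \<mu>m m2 by linarith
    have cT: "c * T\<^sup>2 \<le> c" using c T by (simp add: mult_left_le power_le_one)
    have ends: "\<bar>Re x * Im x\<bar> \<le> B * c * T\<^sup>2 \<and> \<bar>?k * Re x + ?l * Im x - ?k * \<eta>\<bar> \<le> 2 * K * (c * T\<^sup>2)
        \<and> \<sigma> * (?k * Re x - ?l * Im x) > 0 \<and> ?k \<noteq> 0"
      if x: "x \<in> ball (complex_of_real \<eta>) (c * T\<^sup>2)" for x
    proof -
      have d: "norm (x - complex_of_real \<eta>) < c * T\<^sup>2" using x by (simp add: dist_norm norm_minus_commute)
      have re: "\<bar>Re x - \<eta>\<bar> \<le> c * T\<^sup>2" and im: "\<bar>Im x\<bar> \<le> c * T\<^sup>2"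
        using d abs_Re_le_cmod [of "x - complex_of_real \<eta>"] abs_Im_le_cmod [of "x - complex_of_real \<eta>"] by auto
      have "\<bar>Re x\<bar> \<le> B" using re cT c K unfolding B_def by linarith
      then have "\<bar>Re x * Im x\<bar> \<le> B * (c * T\<^sup>2)"
        unfolding abs_mult using im B1 by (intro mult_mono) auto
      moreover have "\<bar>?k * Re x + ?l * Im x - ?k * \<eta>\<bar> \<le> \<bar>?k\<bar> * \<bar>Re x - \<eta>\<bar> + \<bar>?l\<bar> * \<bar>Im x\<bar>"
        unfolding abs_mult [symmetric] by (simp add: algebra_simps)
      moreover have "\<bar>?k\<bar> * \<bar>Re x - \<eta>\<bar> + \<bar>?l\<bar> * \<bar>Im x\<bar> \<le> K * (c * T\<^sup>2) + K * (c * T\<^sup>2)"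
        using re im kK abs_Re_le_cmod [of \<kappa>] abs_Im_le_cmod [of \<kappa>] K
        by (intro add_mono mult_mono) linarith+
      moreover have "dist x (complex_of_real \<eta>) < e" using d cT \<open>c < e\<close> by (simp add: dist_norm)
      ultimately show ?thesis using pos [OF ke] by auto
    qed
    define Qa where "Qa = ?k * Re p + ?l * Im p"
    define Qb where "Qb = ?k * Re q + ?l * Im q"
    have Qab: "\<bar>Qb - Qa\<bar> \<le> B * c * T\<^sup>2"
    proof -
      have "\<bar>Qb - Qa\<bar> \<le> 4 * K * (c * T\<^sup>2)" using ends [OF p] ends [OF q] unfolding Qa_def Qb_def by linarith
      also have "\<dots> \<le> B * (c * T\<^sup>2)" using c unfolding B_def by (intro mult_right_mono) auto
      finally show ?thesis by simp
    qed
    have Bc: "B * c \<ge> 0" using B1 c by simp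
    obtain Q W V where QWV: "\<And>s. (Q has_real_derivative \<mu> * W s) (at s)" "\<And>s. (W has_real_derivative V s) (at s)"
      "continuous_on UNIV V" "Q s\<^sub>0 = Qa" "Q (s\<^sub>0 + T) = Qb" "W s\<^sub>0 = Re p * Im p" "W (s\<^sub>0 + T) = Re q * Im q"
      and b: "\<And>s. s \<in> {s\<^sub>0..s\<^sub>0 + T} \<Longrightarrow> \<bar>Q s - Qa\<bar> \<le> (3 * \<mu> + 1) * (B * c)"
      "\<And>s. s \<in> {s\<^sub>0..s\<^sub>0 + T} \<Longrightarrow> \<bar>W s\<bar> \<le> (8 + 6 / \<mu>) * (B * c)"
      "\<And>s. s \<in> {s\<^sub>0..s\<^sub>0 + T} \<Longrightarrow> \<bar>V s\<bar> \<le> (8 + 6 / \<mu>) * (B * c)"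
      using flat_interpolation [OF T \<mu>0 Bc conjunct1 [OF ends [OF p]] conjunct1 [OF ends [OF q]] Qab] by metis
    have b1: "(8 + 6 / \<mu>) * (B * c) < e"
    proof -
      have "(8 + 6 / \<mu>) * (B * c) \<le> (8 + 6 / (2 * m\<^sup>2)) * (B * c)"
        using \<mu>m m2 Bc by (intro mult_right_mono add_left_mono frac_le) auto
      also have "\<dots> = c * ((8 + 6 / (2 * m\<^sup>2)) * B)" by simp
      also have "\<dots> \<le> c * M" using c M1 unfolding M_def by (intro mult_left_mono) linarith+
      finally show ?thesis using cM by linarith
    qed
    have b2: "2 * K * (c * T\<^sup>2) + (3 * \<mu> + 1) * (B * c) < e"
    proof -
      have "(3 * \<mu> + 1) * (B * c) \<le> (3 * (2 * K\<^sup>2) + 1) * (B * c)"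
        using \<mu>K Bc by (intro mult_right_mono) auto
      moreover have "2 * K * (c * T\<^sup>2) \<le> 2 * K * c" using cT K by (intro mult_left_mono) auto
      ultimately have "2 * K * (c * T\<^sup>2) + (3 * \<mu> + 1) * (B * c) \<le> c * (2 * K + (3 * (2 * K\<^sup>2) + 1) * B)"
        by (simp only: distrib_left distrib_right ac_simps add_mono)
      also have "\<dots> \<le> c * M" using c M1 unfolding M_def by (intro mult_left_mono) linarith+
      finally show ?thesis using cM by linarith
    qed
    have near: "flat_regular \<sigma> ?k ?l (Q s) (W s) \<and> n\<^sub>1\<^sup>2 < flat_control \<sigma> ?k ?l (Q s) (W s) (V s) \<and>
        flat_control \<sigma> ?k ?l (Q s) (W s) (V s) < n\<^sub>2\<^sup>2" if s: "s \<in> {s\<^sub>0..s\<^sub>0 + T}" for s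
    proof -
      have "\<bar>Q s - ?k * \<eta>\<bar> < e" using b(1) [OF s] ends [OF p] b2 unfolding Qa_def by linarith
      moreover have "\<bar>W s\<bar> < e" "\<bar>V s\<bar> < e" using b(2,3) [OF s] b1 by linarith+
      ultimately show ?thesis using reg [OF ke, of "Q s - ?k * \<eta>" "W s" "V s"] by simp
    qed
    have st: "steers n\<^sub>1 n\<^sub>2 s\<^sub>0 \<kappa> T
       (fin (Complex (flat_re \<sigma> ?k ?l (Q s\<^sub>0) (W s\<^sub>0)) (flat_im \<sigma> ?k ?l (Q s\<^sub>0) (W s\<^sub>0))))
       (fin (Complex (flat_re \<sigma> ?k ?l (Q (s\<^sub>0 + T)) (W (s\<^sub>0 + T))) (flat_im \<sigma> ?k ?l (Q (s\<^sub>0 + T)) (W (s\<^sub>0 + T)))))"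
      by (rule steers_flat [OF T(1) \<sigma> _ QWV(2,3)]) (use QWV(1) near in \<open>auto simp: \<mu>_def less_imp_le\<close>)
    have inv: "Complex (flat_re \<sigma> ?k ?l (?k * Re x + ?l * Im x) (Re x * Im x))
        (flat_im \<sigma> ?k ?l (?k * Re x + ?l * Im x) (Re x * Im x)) = x"
      if x: "x \<in> ball (complex_of_real \<eta>) (c * T\<^sup>2)"
        and r: "flat_regular \<sigma> ?k ?l (?k * Re x + ?l * Im x) (Re x * Im x)" for x
    proof -
      have 1: "flat_re \<sigma> ?k ?l (?k * Re x + ?l * Im x) (Re x * Im x) = Re x"
        using ends [OF x] by (intro flat_re_eq \<sigma>) auto
      then have "Re x \<noteq> 0" using r unfolding flat_regular_def by simp
      then show ?thesis unfolding flat_im_def 1 by (simp add: complex_eq_iff)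
    qed
    have "s\<^sub>0 \<in> {s\<^sub>0..s\<^sub>0 + T}" "s\<^sub>0 + T \<in> {s\<^sub>0..s\<^sub>0 + T}" using T by auto
    from near [OF this(1)] near [OF this(2)]
    have rp: "flat_regular \<sigma> ?k ?l (?k * Re p + ?l * Im p) (Re p * Im p)"
      and rq: "flat_regular \<sigma> ?k ?l (?k * Re q + ?l * Im q) (Re q * Im q)"
      unfolding QWV(4-7) Qa_def Qb_def by blast+
    show "steers n\<^sub>1 n\<^sub>2 s\<^sub>0 \<kappa> T (fin p) (fin q)"
      using st unfolding QWV(4-7) Qa_def Qb_def inv [OF p rp] inv [OF q rq] .
  qed
qed

section \<open>Caratheodory solutions of the Riccati equation and the change of chart\<close>

text \<open>
  Both charts carry an equation of this form: \<open>A = \<epsilon>\<close>, \<open>B = - 1\<close> in the finite chart, and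
  \<open>A = - 1\<close>, \<open>B = \<epsilon>\<close> at infinity.
\<close>
definition riccati :: "complex \<Rightarrow> (real \<Rightarrow> complex) \<Rightarrow> (real \<Rightarrow> complex) \<Rightarrow> real \<Rightarrow> complex \<Rightarrow> complex" where
  "riccati \<kappa> A B u z = \<i> * \<kappa> * (A u + B u * z\<^sup>2)"

lemma caratheodory_subset:
  "caratheodory_solution J f z \<Longrightarrow> J' \<subseteq> J \<Longrightarrow> caratheodory_solution J' f z"
  unfolding caratheodory_solution_def by blast

text \<open>
  Changing the right-hand side on a null set of times does not affect solutions; this allows the
  control bounds to be assumed everywhere instead of almost everywhere.
\<close>
lemma caratheodory_spike:
  assumes car: "caratheodory_solution J f z" and J: "is_interval J" and N: "negligible N"
    and zw: "\<And>u. u \<in> J \<Longrightarrow> z u = w u"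
    and fg: "\<And>u. u \<in> J \<Longrightarrow> u \<notin> N \<Longrightarrow> f u (z u) = g u (w u)"
  shows "caratheodory_solution J g w"
  unfolding caratheodory_solution_def
proof (intro ballI impI conjI)
  fix a b assume ab: "a \<in> J" "b \<in> J" "a \<le> b"
  have sub: "{a..b} \<subseteq> J" using ab J unfolding is_interval_1 by (meson atLeastAtMost_iff subsetI)
  have int: "(\<lambda>s. f s (z s)) absolutely_integrable_on {a..b}"
    and eq: "z b - z a = integral {a..b} (\<lambda>s. f s (z s))"
    using car ab unfolding caratheodory_solution_def by auto
  show "(\<lambda>s. g s (w s)) absolutely_integrable_on {a..b}"
    by (rule absolutely_integrable_spike [OF int N]) (use fg sub in auto)
  have "integral {a..b} (\<lambda>s. f s (z s)) = integral {a..b} (\<lambda>s. g s (w s))"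
    by (rule integral_spike [OF N]) (use fg sub in auto)
  then show "w b - w a = integral {a..b} (\<lambda>s. g s (w s))" using eq zw ab by auto
qed

lemma caratheodory_continuous:
  assumes "caratheodory_solution {a..b} f z"
  shows "continuous_on {a..b} z"
proof (cases "a \<le> b")
  case True
  have car: "(\<lambda>s. f s (z s)) absolutely_integrable_on {a..u}" "z u - z a = integral {a..u} (\<lambda>s. f s (z s))"
    if "u \<in> {a..b}" for u
    using assms that unfolding caratheodory_solution_def by auto
  have "continuous_on {a..b} (\<lambda>u. z a + integral {a..u} (\<lambda>s. f s (z s)))"
    by (intro continuous_intros indefinite_integral_continuous_1 set_lebesgue_integral_eq_integral(1) car) (use True in auto)
  then show ?thesis
  proof (rule continuous_on_eq)
    show "z a + integral {a..u} (\<lambda>s. f s (z s)) = z u" if "u \<in> {a..b}" for u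
      using car(2) [OF that] by (simp add: algebra_simps)
  qed
qed auto

lemma caratheodory_lipschitz:
  assumes car: "caratheodory_solution {a..b} f z"
    and C: "\<And>u. u \<in> {a..b} \<Longrightarrow> norm (f u (z u)) \<le> C"
    and s: "s \<in> {a..b}" and t: "t \<in> {a..b}"
  shows "norm (z t - z s) \<le> C * \<bar>t - s\<bar>"
proof -
  have *: "norm (z t - z s) \<le> C * (t - s)" if "s \<le> t" "s \<in> {a..b}" "t \<in> {a..b}" for s t
  proof -
    have int: "(\<lambda>u. f u (z u)) absolutely_integrable_on {s..t}"
      and eq: "z t - z s = integral {s..t} (\<lambda>u. f u (z u))"
      using car that unfolding caratheodory_solution_def by auto
    have "norm (integral {s..t} (\<lambda>u. f u (z u))) \<le> integral {s..t} (\<lambda>u. C)"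
      by (rule integral_norm_bound_integral)
        (use set_lebesgue_integral_eq_integral(1) [OF int] C that in auto)
    then show ?thesis using eq that by (simp add: mult.commute)
  qed
  show ?thesis
    using *[OF _ s t] *[OF _ t s] by (cases "s \<le> t") (auto simp: norm_minus_commute)
qed

lemma caratheodory_local:
  assumes loc: "\<And>s. s \<in> {a..b} \<Longrightarrow> \<exists>h>0. caratheodory_solution ({a..b} \<inter> {s - h..s + h}) f z"
  shows "caratheodory_solution {a..b} f z"
proof (cases "a \<le> b")
  case True
  have glue: "caratheodory_solution {p..r} f z"
    if 1: "caratheodory_solution {p..q} f z" and 2: "caratheodory_solution {q..r} f z" and pqr: "p \<le> q" "q \<le> r" for p q r
    unfolding caratheodory_solution_def
  proof (intro ballI impI)
    fix s t assume st: "s \<in> {p..r}" "t \<in> {p..r}" "s \<le> t"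
    consider "t \<le> q" | "q \<le> s" | "s < q" "q < t" by linarith
    then show "(\<lambda>s. f s (z s)) absolutely_integrable_on {s..t} \<and> z t - z s = integral {s..t} (\<lambda>s. f s (z s))"
    proof cases
      case 3
      have l: "(\<lambda>s. f s (z s)) absolutely_integrable_on {s..q} \<and> z q - z s = integral {s..q} (\<lambda>s. f s (z s))"
        and r: "(\<lambda>s. f s (z s)) absolutely_integrable_on {q..t} \<and> z t - z q = integral {q..t} (\<lambda>s. f s (z s))"
        using 1 2 3 st unfolding caratheodory_solution_def by auto
      have i: "(\<lambda>s. f s (z s)) absolutely_integrable_on {s..t}"
        using absolutely_integrable_on_combine l r 3 by (meson less_imp_le)
      have "integral {s..q} (\<lambda>s. f s (z s)) + integral {q..t} (\<lambda>s. f s (z s)) = integral {s..t} (\<lambda>s. f s (z s))"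
        by (rule Henstock_Kurzweil_Integration.integral_combine)
          (use 3 set_lebesgue_integral_eq_integral(1) [OF i] in auto)
      then have "z t - z s = integral {s..t} (\<lambda>s. f s (z s))"
        using l r by (metis add.commute diff_add_cancel add_diff_eq)
      then show ?thesis using i by simp
    qed (use 1 2 st in \<open>auto simp: caratheodory_solution_def\<close>)
  qed
  define P where "P = (\<lambda>p q. a \<le> p \<and> q \<le> b \<longrightarrow> caratheodory_solution {p..q} f z)"
  have "P a b"
    using True
  proof (induction rule: Bolzano)
    case (trans p q r)
    then show ?case unfolding P_def using glue by auto
  next
    case (local x)
    then obtain h where h: "h > 0" "caratheodory_solution ({a..b} \<inter> {x - h..x + h}) f z"
      using loc [of x] by auto
    show ?case
      unfolding P_def by (rule exI [of _ h]) (auto simp: h intro!: caratheodory_subset [OF h(2)])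
  qed
  then show ?thesis unfolding P_def by simp
qed (simp add: caratheodory_solution_def)

text \<open>
  A Lipschitz bound at each point, with one constant and neighbourhoods that may depend on the point,
  adds up along the interval by bisection.
\<close>
lemma lipschitz_local:
  fixes D :: "real \<Rightarrow> 'a::real_normed_vector"
  assumes ab: "a \<le> b"
    and loc: "\<And>s. s \<in> {a..b} \<Longrightarrow> \<exists>h>0. \<forall>u\<in>{a..b} \<inter> {s - h..s + h}. norm (D u - D s) \<le> C * \<bar>u - s\<bar>"
  shows "norm (D b - D a) \<le> C * (b - a)"
proof -
  define P where "P = (\<lambda>p q. a \<le> p \<and> q \<le> b \<longrightarrow> norm (D q - D p) \<le> C * (q - p))"
  have "P a b"
    using ab
  proof (induction rule: Bolzano)
    case (trans p q r)
    show ?case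
      unfolding P_def
    proof
      assume "a \<le> p \<and> r \<le> b"
      then have "norm (D q - D p) \<le> C * (q - p)" "norm (D r - D q) \<le> C * (r - q)"
        using trans unfolding P_def by auto
      then show "norm (D r - D p) \<le> C * (r - p)"
        using norm_triangle_ineq [of "D r - D q" "D q - D p"] by (simp add: algebra_simps)
    qed
  next
    case (local x)
    then obtain h where h: "h > 0" "\<forall>u\<in>{a..b} \<inter> {x - h..x + h}. norm (D u - D x) \<le> C * \<bar>u - x\<bar>"
      using loc [of x] by auto
    have near: "norm (D u - D x) \<le> C * \<bar>u - x\<bar>" if "a \<le> u" "u \<le> b" "\<bar>u - x\<bar> \<le> h" for u
      by (rule bspec [OF h(2)]) (use that in auto)
    have "norm (D q - D p) \<le> C * (q - p)" if "p \<le> x" "x \<le> q" "q - p < h" "a \<le> p" "q \<le> b" for p q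
    proof -
      have "norm (D q - D x) \<le> C * (q - x)" "norm (D p - D x) \<le> C * (x - p)"
        using near [of q] near [of p] that by auto
      then show ?thesis
        using norm_triangle_ineq4 [of "D q - D x" "D p - D x"] by (simp add: algebra_simps)
    qed
    then show ?case unfolding P_def using h(1) by blast
  qed
  then show ?thesis unfolding P_def by simp
qed

text \<open>
  An additive interval function that is quadratically small on short intervals has Lipschitz constant
  \<open>e\<close> on short enough intervals, for every \<open>e > 0\<close>, and therefore vanishes.
\<close>
lemma additive_quadratic_increment_zero:
  fixes \<Phi> :: "real \<Rightarrow> real \<Rightarrow> 'a::real_normed_vector"
  assumes ab: "a \<le> b" and K: "K \<ge> 0"
    and add: "\<And>r s t. a \<le> r \<Longrightarrow> r \<le> s \<Longrightarrow> s \<le> t \<Longrightarrow> t \<le> b \<Longrightarrow> \<Phi> r t = \<Phi> r s + \<Phi> s t"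
    and quad: "\<And>r s. a \<le> r \<Longrightarrow> r \<le> s \<Longrightarrow> s \<le> b \<Longrightarrow> norm (\<Phi> r s) \<le> K * (s - r)\<^sup>2"
  shows "\<Phi> a b = 0"
proof -
  have diff: "\<Phi> a t - \<Phi> a s = \<Phi> s t" if "a \<le> s" "s \<le> t" "t \<le> b" for s t
    using add [of a s t] that by simp
  have bound: "norm (\<Phi> a b) \<le> e" if e: "e > 0" for e
  proof -
    define h where "h = e / ((b - a + 1) * (K + 1))"
    have h: "h > 0" using e ab K unfolding h_def by simp
    have Kh: "K * h \<le> e / (b - a + 1)"
    proof -
      have "K * h \<le> (K + 1) * h" using h by simp
      also have "\<dots> = e / (b - a + 1)" unfolding h_def using K by simp
      finally show ?thesis .
    qed
    have q: "norm (\<Phi> p q) \<le> e / (b - a + 1) * (q - p)" if "a \<le> p" "p \<le> q" "q \<le> b" "q - p \<le> h" for p q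
    proof -
      have "norm (\<Phi> p q) \<le> K * (q - p) * (q - p)" using quad [of p q] that by (simp add: power2_eq_square mult.assoc)
      also have "\<dots> \<le> e / (b - a + 1) * (q - p)"
        using that K Kh mult_left_mono [of "q - p" h K] by (intro mult_right_mono) auto
      finally show ?thesis .
    qed
    have "norm (\<Phi> a b - \<Phi> a a) \<le> e / (b - a + 1) * (b - a)"
    proof (rule lipschitz_local [OF ab])
      fix s assume s: "s \<in> {a..b}"
      have "norm (\<Phi> a u - \<Phi> a s) \<le> e / (b - a + 1) * \<bar>u - s\<bar>" if u: "u \<in> {a..b} \<inter> {s - h..s + h}" for u
      proof (cases "s \<le> u")
        case True
        then show ?thesis using q [of s u] diff [of s u] s u by auto
      next
        case False
        then show ?thesis using q [of u s] diff [of u s] s u by (auto simp: norm_minus_commute)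
      qed
      then show "\<exists>h>0. \<forall>u\<in>{a..b} \<inter> {s - h..s + h}. norm (\<Phi> a u - \<Phi> a s) \<le> e / (b - a + 1) * \<bar>u - s\<bar>"
        using h by blast
    qed
    also have "\<dots> \<le> e" using ab e by (simp add: field_simps)
    finally show ?thesis using add [of a a a] ab by simp
  qed
  then show ?thesis by (metis dense_ge norm_le_zero_iff)
qed

text \<open>
  The chain rule for \<open>z = - 1 / y\<close>. Over a short interval the increment of \<open>z\<close> is the integral of
  \<open>y'\<close> times \<open>1 / (y(p) y(q))\<close>, where the required integrand is \<open>y'\<close> times
  \<open>1 / y\<^sup>2\<close>. Since \<open>y'\<close> is bounded, \<open>y\<close> is Lipschitz and the error is quadratic in the length of the
  interval, so that \<open>additive_quadratic_increment_zero\<close> applies.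
\<close>
lemma riccati_chart_change:
  assumes car: "caratheodory_solution {a..b} (riccati \<kappa> A B) y"
    and y0: "\<And>u. u \<in> {a..b} \<Longrightarrow> y u \<noteq> 0"
    and M: "\<And>u. norm (A u) \<le> M" "\<And>u. norm (B u) \<le> M"
  shows "caratheodory_solution {a..b} (riccati \<kappa> B A) (\<lambda>u. - 1 / y u)"
proof -
  define F where "F = (\<lambda>u. riccati \<kappa> A B u (y u))"
  define z where "z = (\<lambda>u. - 1 / y u)"
  have M0: "M \<ge> 0" using M(1) [of 0] norm_ge_zero order_trans by blast
  have cy: "continuous_on {a..b} y" by (rule caratheodory_continuous [OF car])
  have ci: "continuous_on {a..b} (\<lambda>u. inverse (y u))"
    using y0 by (intro continuous_intros cy) auto
  obtain Y where Y: "\<And>u. u \<in> {a..b} \<Longrightarrow> norm (y u) \<le> Y"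
    using compact_imp_bounded [OF compact_continuous_image [OF cy compact_Icc]] unfolding bounded_iff by blast
  obtain R where R: "\<And>u. u \<in> {a..b} \<Longrightarrow> norm (inverse (y u)) \<le> R"
    using compact_imp_bounded [OF compact_continuous_image [OF ci compact_Icc]] unfolding bounded_iff by blast
  define C where "C = norm \<kappa> * (M + M * Y\<^sup>2)"
  have FC: "norm (F u) \<le> C" if u: "u \<in> {a..b}" for u
  proof -
    have "norm (A u + B u * (y u)\<^sup>2) \<le> M + M * Y\<^sup>2"
      using M Y [OF u] M0
      by (intro order_trans [OF norm_triangle_ineq] add_mono)
        (auto simp: norm_mult norm_power intro!: mult_mono power_mono)
    then show ?thesis unfolding F_def riccati_def C_def by (simp add: norm_mult mult_left_mono)
  qed
  have Fz: "riccati \<kappa> B A u (z u) = F u * (inverse (y u))\<^sup>2" if "u \<in> {a..b}" for u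
    using y0 [OF that] unfolding riccati_def F_def z_def by (simp add: field_simps)
  show ?thesis
    unfolding caratheodory_solution_def z_def [symmetric]
  proof (intro ballI impI conjI)
    fix s t assume st: "s \<in> {a..b}" "t \<in> {a..b}" "s \<le> t"
    have sub: "{s..t} \<subseteq> {a..b}" using st by auto
    have Fi: "F absolutely_integrable_on {p..q}" and Fe: "y q - y p = integral {p..q} F"
      if "p \<in> {a..b}" "q \<in> {a..b}" "p \<le> q" for p q
      using car that unfolding caratheodory_solution_def F_def by auto
    have zi0: "(\<lambda>u. (inverse (y u))\<^sup>2 * F u) absolutely_integrable_on {s..t}"
    proof (rule absolutely_integrable_bounded_measurable_product
          [where h = "(*)" and f = "\<lambda>u. (inverse (y u))\<^sup>2", OF _ _ _ _ Fi])
      show "bilinear ((*) :: complex \<Rightarrow> complex \<Rightarrow> complex)" by (rule bilinear_times)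
      have c: "continuous_on {s..t} (\<lambda>u. (inverse (y u))\<^sup>2)"
        by (intro continuous_intros continuous_on_subset [OF ci sub]) 
      show "(\<lambda>u. (inverse (y u))\<^sup>2) \<in> borel_measurable (lebesgue_on {s..t})"
        by (rule continuous_imp_measurable_on_sets_lebesgue [OF c]) auto
      show "bounded ((\<lambda>u. (inverse (y u))\<^sup>2) ` {s..t})"
        by (rule compact_imp_bounded [OF compact_continuous_image [OF c compact_Icc]])
    qed (use st in auto)
    then have zi: "(\<lambda>u. F u * (inverse (y u))\<^sup>2) absolutely_integrable_on {s..t}"
      by (simp add: mult.commute)
    then show "(\<lambda>u. riccati \<kappa> B A u (z u)) absolutely_integrable_on {s..t}"
      by (rule absolutely_integrable_spike [of _ _ "{}"]) (use Fz sub in auto)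
    have zI: "(\<lambda>u. F u * (inverse (y u))\<^sup>2) integrable_on {p..q}" if "s \<le> p" "q \<le> t" for p q
      using set_lebesgue_integral_eq_integral(1) [OF zi] that by (auto intro: integrable_subinterval_real)
    define \<Phi> where "\<Phi> = (\<lambda>p q. z q - z p - integral {p..q} (\<lambda>u. F u * (inverse (y u))\<^sup>2))"
    have R0: "R \<ge> 0" using R [OF st(1)] norm_ge_zero order_trans by blast
    have Y0: "Y \<ge> 0" using Y [OF st(1)] norm_ge_zero order_trans by blast
    have C0: "C \<ge> 0" unfolding C_def using M0 by simp
    have "\<Phi> s t = 0"
    proof (rule additive_quadratic_increment_zero [OF st(3)])
      show "0 \<le> C * (R^4 * (2 * Y * C))" using C0 R0 Y0 by simp
    next
      fix p q r assume pqr: "s \<le> p" "p \<le> q" "q \<le> r" "r \<le> t"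
      have "integral {p..q} (\<lambda>u. F u * (inverse (y u))\<^sup>2) + integral {q..r} (\<lambda>u. F u * (inverse (y u))\<^sup>2)
          = integral {p..r} (\<lambda>u. F u * (inverse (y u))\<^sup>2)"
        by (rule Henstock_Kurzweil_Integration.integral_combine) (use pqr zI in auto)
      then show "\<Phi> p r = \<Phi> p q + \<Phi> q r" unfolding \<Phi>_def by (simp add: algebra_simps)
    next
      fix p q assume pq: "s \<le> p" "p \<le> q" "q \<le> t"
      have pab: "p \<in> {a..b}" and qab: "q \<in> {a..b}" using pq st by auto
      let ?w = "inverse (y p) * inverse (y q)"
      have "z q - z p = (y q - y p) * ?w"
        unfolding z_def using y0 [OF pab] y0 [OF qab] by (simp add: field_simps)
      also have "\<dots> = integral {p..q} (\<lambda>u. F u * ?w)"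
        unfolding Fe [OF pab qab pq(2)] by simp
      finally have "\<Phi> p q = integral {p..q} (\<lambda>u. F u * ?w) - integral {p..q} (\<lambda>u. F u * (inverse (y u))\<^sup>2)"
        unfolding \<Phi>_def by simp
      also have "\<dots> = integral {p..q} (\<lambda>u. F u * ?w - F u * (inverse (y u))\<^sup>2)"
        using set_lebesgue_integral_eq_integral(1) [OF Fi [OF pab qab pq(2)]] zI pq
        by (intro Henstock_Kurzweil_Integration.integral_diff [symmetric] integrable_on_mult_left) auto
      finally have \<Phi>: "\<Phi> p q = integral {p..q} (\<lambda>u. F u * ?w - F u * (inverse (y u))\<^sup>2)" .
      have "norm (\<Phi> p q) \<le> integral {p..q} (\<lambda>u. C * (R^4 * (2 * Y * C)) * (q - p))"
        unfolding \<Phi>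
      proof (rule integral_norm_bound_integral)
        show "(\<lambda>u. F u * ?w - F u * (inverse (y u))\<^sup>2) integrable_on {p..q}"
          using set_lebesgue_integral_eq_integral(1) [OF Fi [OF pab qab pq(2)]] zI pq
          by (intro integrable_diff integrable_on_mult_left) auto
      next
        fix u assume u: "u \<in> {p..q}"
        have uab: "u \<in> {a..b}" using u pab qab by auto
        have lip: "norm (y u - y v) \<le> C * (q - p)" if "v = p \<or> v = q" for v
        proof -
          have "norm (y u - y v) \<le> C * \<bar>u - v\<bar>"
            by (rule caratheodory_lipschitz [OF car]) (use FC uab pab qab that in \<open>auto simp: F_def\<close>)
          also have "\<dots> \<le> C * (q - p)" using u that C0 by (intro mult_left_mono) auto
          finally show ?thesis .
        qed
        have "?w - (inverse (y u))\<^sup>2 =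
           ?w * (inverse (y u))\<^sup>2 * (y u * (y u - y p) + y p * (y u - y q))"
          using y0 [OF pab] y0 [OF qab] y0 [OF uab] by (simp add: field_simps power2_eq_square)
        also have "norm \<dots> \<le> (R * R * R\<^sup>2) * (Y * (C * (q - p)) + Y * (C * (q - p)))"
          unfolding norm_mult norm_power
          using R [OF pab] R [OF qab] R [OF uab] Y [OF pab] Y [OF uab] lip R0 Y0 C0 pq
          by (intro mult_mono order_trans [OF norm_triangle_ineq] add_mono power_mono)
             (auto simp: norm_mult intro!: mult_mono)
        also have "\<dots> = R^4 * (2 * Y * C) * (q - p)"
          by (simp add: power2_eq_square power4_eq_xxxx algebra_simps)
        finally have w: "norm (?w - (inverse (y u))\<^sup>2) \<le> R^4 * (2 * Y * C) * (q - p)" .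
        have "norm (F u * ?w - F u * (inverse (y u))\<^sup>2) = norm (F u) * norm (?w - (inverse (y u))\<^sup>2)"
          by (simp only: right_diff_distrib [symmetric] norm_mult)
        also have "\<dots> \<le> C * (R^4 * (2 * Y * C) * (q - p))"
          using FC [OF uab] w C0 by (intro mult_mono) auto
        finally show "norm (F u * ?w - F u * (inverse (y u))\<^sup>2) \<le> C * (R^4 * (2 * Y * C)) * (q - p)"
          by (simp add: mult.assoc)
      qed auto
      then show "norm (\<Phi> p q) \<le> C * (R^4 * (2 * Y * C)) * (q - p)\<^sup>2"
        using pq by (simp add: power2_eq_square mult.assoc mult.commute mult.left_commute)
    qed
    then have "z t - z s = integral {s..t} (\<lambda>u. F u * (inverse (y u))\<^sup>2)" unfolding \<Phi>_def by simp
    also have "\<dots> = integral {s..t} (\<lambda>u. riccati \<kappa> B A u (z u))"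
      by (rule integral_cong) (use Fz sub in auto)
    finally show "z t - z s = integral {s..t} (\<lambda>u. riccati \<kappa> B A u (z u))" .
  qed
qed


section \<open>Paths on the sphere stay in one chart for a short time\<close>

text \<open>
  The two charts enter symmetrically, so the arguments below are carried out for an abstract chart
  \<open>\<phi>\<close>, defined away from \<open>pole\<close>, and an opposite chart \<open>\<psi>\<close>, defined away from \<open>zer\<close>, the zero
  of \<open>\<phi>\<close>. They are then used for \<open>x\<close> and \<open>- 1 / x\<close> in either order.
\<close>
definition local_riccati ::
    "(csphere \<Rightarrow> complex) \<Rightarrow> csphere \<Rightarrow> complex \<Rightarrow> (real \<Rightarrow> complex) \<Rightarrow> (real \<Rightarrow> complex) \<Rightarrow>
     real set \<Rightarrow> (real \<Rightarrow> csphere) \<Rightarrow> bool" where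
  "local_riccati \<phi> pole \<kappa> A B J x \<longleftrightarrow>
     (\<forall>u\<in>J. x u \<noteq> pole) \<and> caratheodory_solution J (riccati \<kappa> A B) (\<lambda>u. \<phi> (x u))"

definition opposite_charts ::
    "(csphere \<Rightarrow> complex) \<Rightarrow> csphere \<Rightarrow> (csphere \<Rightarrow> complex) \<Rightarrow> csphere \<Rightarrow> bool" where
  "opposite_charts \<phi> pole \<psi> zer \<longleftrightarrow>
     \<psi> pole = 0 \<and> (\<forall>y. y \<noteq> pole \<longrightarrow> y \<noteq> zer \<longrightarrow> \<psi> y \<noteq> 0 \<and> \<phi> y = - 1 / \<psi> y)"

lemma opposite_charts_standard:
  "opposite_charts the infty chart_infty (fin 0)" "opposite_charts chart_infty (fin 0) the infty"
  unfolding opposite_charts_def by (auto simp: not_None_eq)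

definition two_chart_path ::
    "(csphere \<Rightarrow> complex) \<Rightarrow> csphere \<Rightarrow> (csphere \<Rightarrow> complex) \<Rightarrow> csphere \<Rightarrow> complex \<Rightarrow>
     (real \<Rightarrow> complex) \<Rightarrow> (real \<Rightarrow> complex) \<Rightarrow> real \<Rightarrow> real \<Rightarrow> (real \<Rightarrow> csphere) \<Rightarrow> bool" where
  "two_chart_path \<phi> pole \<psi> zer \<kappa> A B a b x \<longleftrightarrow>
     (\<forall>s\<in>{a..b}. \<exists>h>0. local_riccati \<phi> pole \<kappa> A B ({a..b} \<inter> {s - h..s + h}) x \<or>
                       local_riccati \<psi> zer \<kappa> B A ({a..b} \<inter> {s - h..s + h}) x)"

lemma local_riccati_subset:
  "local_riccati \<phi> pole \<kappa> A B J x \<Longrightarrow> J' \<subseteq> J \<Longrightarrow> local_riccati \<phi> pole \<kappa> A B J' x"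
  unfolding local_riccati_def using caratheodory_subset by blast

lemma local_riccati_continuous:
  assumes "local_riccati \<phi> pole \<kappa> A B ({a..b} \<inter> {s - h..s + h}) x" "0 < h" "s \<in> {a..b}" "0 < e"
  obtains d where "0 < d" "d \<le> h"
    "\<And>u. u \<in> {a..b} \<inter> {s - d..s + d} \<Longrightarrow> norm (\<phi> (x u) - \<phi> (x s)) < e"
proof -
  have J: "{a..b} \<inter> {s - h..s + h} = {max a (s - h)..min b (s + h)}" by auto
  have "continuous_on ({a..b} \<inter> {s - h..s + h}) (\<lambda>u. \<phi> (x u))"
    using assms(1) unfolding local_riccati_def J using caratheodory_continuous by blast
  moreover have "s \<in> {a..b} \<inter> {s - h..s + h}" using assms by auto
  ultimately obtain d where d: "d > 0" and dd: "\<And>u. u \<in> {a..b} \<inter> {s - h..s + h} \<Longrightarrow> dist u s < d \<Longrightarrow> dist (\<phi> (x u)) (\<phi> (x s)) < e"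
    using assms(4) unfolding continuous_on_iff by blast
  show thesis
  proof (rule that [of "min h (d / 2)"])
    fix u assume u: "u \<in> {a..b} \<inter> {s - min h (d / 2)..s + min h (d / 2)}"
    have us: "\<bar>u - s\<bar> \<le> min h (d / 2)" using u unfolding Int_iff atLeastAtMost_iff by linarith
    then have "\<bar>u - s\<bar> \<le> h" "\<bar>u - s\<bar> \<le> d / 2" by simp_all
    then have "u \<in> {a..b} \<inter> {s - h..s + h}" "dist u s < d"
      using u d unfolding Int_iff atLeastAtMost_iff dist_real_def by linarith+
    then show "norm (\<phi> (x u) - \<phi> (x s)) < e" using dd by (simp add: dist_norm)
  qed (use assms d in auto)
qed

text \<open>
  Near a time at which the state is not the pole of \<open>\<phi>\<close>, the path solves the equation of the chart
  \<open>\<phi>\<close>: if it is only known to solve that of \<open>\<psi>\<close>, then \<open>\<psi>\<close> stays away from zero by continuity and the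
  solution can be transported.
\<close>
lemma two_chart_path_at:
  assumes path: "two_chart_path \<phi> pole \<psi> zer \<kappa> A B a b x"
    and charts: "opposite_charts \<phi> pole \<psi> zer"
    and M: "\<And>u. norm (A u) \<le> M" "\<And>u. norm (B u) \<le> M"
    and s: "s \<in> {a..b}" "x s \<noteq> pole"
  obtains h where "0 < h" "local_riccati \<phi> pole \<kappa> A B ({a..b} \<inter> {s - h..s + h}) x"
proof -
  obtain h where h: "0 < h" and alt: "local_riccati \<phi> pole \<kappa> A B ({a..b} \<inter> {s - h..s + h}) x \<or>
      local_riccati \<psi> zer \<kappa> B A ({a..b} \<inter> {s - h..s + h}) x"
    using path s(1) unfolding two_chart_path_def by blast
  show thesis
  proof (cases "local_riccati \<phi> pole \<kappa> A B ({a..b} \<inter> {s - h..s + h}) x")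
    case True
    then show thesis using that h by blast
  next
    case False
    then have \<psi>: "local_riccati \<psi> zer \<kappa> B A ({a..b} \<inter> {s - h..s + h}) x" using alt by blast
    have "x s \<noteq> zer" using \<psi> h s unfolding local_riccati_def by auto
    then have "norm (\<psi> (x s)) > 0" using charts s(2) unfolding opposite_charts_def by auto
    then obtain d where d: "0 < d" "d \<le> h" and
      dd: "\<And>u. u \<in> {a..b} \<inter> {s - d..s + d} \<Longrightarrow> norm (\<psi> (x u) - \<psi> (x s)) < norm (\<psi> (x s))"
      using local_riccati_continuous [OF \<psi> h s(1)] by blast
    define J where "J = {a..b} \<inter> {s - d..s + d}"
    have J: "J = {max a (s - d)..min b (s + d)}" unfolding J_def by auto
    have sub: "J \<subseteq> {a..b} \<inter> {s - h..s + h}" using d unfolding J_def by auto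
    have \<psi>0: "\<psi> (x u) \<noteq> 0" if "u \<in> J" for u
      using dd [of u] that unfolding J_def by auto
    then have np: "x u \<noteq> pole" if "u \<in> J" for u
      using charts that unfolding opposite_charts_def by metis
    have \<phi>: "\<phi> (x u) = - 1 / \<psi> (x u)" if "u \<in> J" for u
      using charts np [OF that] \<psi> sub that unfolding opposite_charts_def local_riccati_def by blast
    have "caratheodory_solution J (riccati \<kappa> B A) (\<lambda>u. \<psi> (x u))"
      using local_riccati_subset [OF \<psi> sub] unfolding local_riccati_def by blast
    then have "caratheodory_solution J (riccati \<kappa> A B) (\<lambda>u. - 1 / \<psi> (x u))"
      using riccati_chart_change [of _ _ \<kappa> B A "\<lambda>u. \<psi> (x u)" M] M \<psi>0 unfolding J by blast
    then have "caratheodory_solution J (riccati \<kappa> A B) (\<lambda>u. \<phi> (x u))"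
      by (rule caratheodory_spike [OF _ _ negligible_empty])
        (use \<phi> in \<open>simp_all add: J is_interval_cc\<close>)
    then have "local_riccati \<phi> pole \<kappa> A B J x" unfolding local_riccati_def using np by blast
    then show thesis using that d(1) unfolding J_def by blast
  qed
qed

text \<open>
  The truncated distance \<open>D = min 1 \<bar>\<phi>(x) - \<phi>(x c)\<bar>\<close>, set to \<open>1\<close> at the pole, is Lipschitz along the path:
  while \<open>\<phi>(x)\<close> is within \<open>2\<close> of \<open>\<phi>(x c)\<close> the velocity in the chart is bounded by \<open>C\<close>, and farther away, in
  particular near the pole, \<open>D\<close> is constantly \<open>1\<close>. As \<open>D\<close> vanishes at \<open>c\<close>, it stays below \<open>1\<close> on an interval shorter than
  \<open>1 / C\<close>. The reference time \<open>c\<close> may be either end of the interval.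
\<close>
lemma two_chart_path_confined:
  assumes path: "two_chart_path \<phi> pole \<psi> zer \<kappa> A B a b x"
    and charts: "opposite_charts \<phi> pole \<psi> zer"
    and M: "\<And>u. norm (A u) \<le> M" "\<And>u. norm (B u) \<le> M"
    and c: "c \<in> {a..b}" "x c \<noteq> pole"
    and short: "norm \<kappa> * (M + M * (norm (\<phi> (x c)) + 2)\<^sup>2) * (b - a) < 1"
  shows "\<And>s. s \<in> {a..b} \<Longrightarrow> norm (\<phi> (x s) - \<phi> (x c)) < 1"
    and "caratheodory_solution {a..b} (riccati \<kappa> A B) (\<lambda>u. \<phi> (x u))"
    and "\<And>s. s \<in> {a..b} \<Longrightarrow> x s \<noteq> pole"
proof -
  define e where "e = \<phi> (x c)"
  define D where "D = (\<lambda>s. if x s = pole then 1 else min 1 (norm (\<phi> (x s) - e)))"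
  define C where "C = norm \<kappa> * (M + M * (norm e + 2)\<^sup>2)"
  have M0: "M \<ge> 0" using M(1) [of 0] norm_ge_zero order_trans by blast
  have C0: "C \<ge> 0" unfolding C_def using M0 by simp
  have D1: "D u = 1" if "x u \<noteq> pole \<Longrightarrow> 1 \<le> norm (\<phi> (x u) - e)" for u
    using that unfolding D_def by auto
  have loc: "\<exists>h>0. \<forall>u\<in>{a..b} \<inter> {s - h..s + h}. norm (D u - D s) \<le> C * \<bar>u - s\<bar>" if s: "s \<in> {a..b}" for s
  proof (cases "x s = pole")
    case False
    obtain h where h: "0 < h" and loc: "local_riccati \<phi> pole \<kappa> A B ({a..b} \<inter> {s - h..s + h}) x"
      using two_chart_path_at [OF path charts M s False] by blast
    obtain d where d: "0 < d" "d \<le> h" and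
      dd: "\<And>u. u \<in> {a..b} \<inter> {s - d..s + d} \<Longrightarrow> norm (\<phi> (x u) - \<phi> (x s)) < 1 / 2"
      by (rule local_riccati_continuous [OF loc h s, of "1/2"]) auto
    define J where "J = {a..b} \<inter> {s - d..s + d}"
    have J: "J = {max a (s - d)..min b (s + d)}" unfolding J_def by auto
    have sJ: "s \<in> J" using s d unfolding J_def by auto
    have locJ: "local_riccati \<phi> pole \<kappa> A B J x"
      by (rule local_riccati_subset [OF loc]) (use d J_def in auto)
    have "norm (D u - D s) \<le> C * \<bar>u - s\<bar>" if u: "u \<in> J" for u
      \<comment> \<open>Beyond \<open>3/2\<close> the chart value moves by less than \<open>1/2\<close>, so \<open>D\<close> is constantly \<open>1\<close>; otherwise the
        velocity is bounded on the whole neighbourhood.\<close>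
    proof (cases "norm (\<phi> (x s) - e) > 3 / 2")
      case True
      have "norm (\<phi> (x s) - e) \<le> norm (\<phi> (x u) - \<phi> (x s)) + norm (\<phi> (x u) - e)"
        using norm_triangle_ineq4 [of "\<phi> (x u) - e" "\<phi> (x u) - \<phi> (x s)"] by simp
      then have "1 \<le> norm (\<phi> (x u) - e)" using dd [of u] u True unfolding J_def by linarith
      then have "D u = 1" "D s = 1" using True by (auto intro!: D1)
      then show ?thesis using C0 by simp
    next
      case False
      have bnd: "norm (riccati \<kappa> A B v (\<phi> (x v))) \<le> C" if v: "v \<in> J" for v
      proof -
        have "norm (\<phi> (x v)) \<le> norm (\<phi> (x v) - \<phi> (x s)) + norm (\<phi> (x s) - e) + norm e"
          using norm_triangle_ineq [of "\<phi> (x v) - \<phi> (x s)" "\<phi> (x s)"] norm_triangle_ineq [of "\<phi> (x s) - e" e] by simp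
        then have "norm (\<phi> (x v)) \<le> norm e + 2" using dd [of v] v False unfolding J_def by simp
        then have "norm (A v + B v * (\<phi> (x v))\<^sup>2) \<le> M + M * (norm e + 2)\<^sup>2"
          using M M0 by (intro order_trans [OF norm_triangle_ineq] add_mono)
            (auto simp: norm_mult norm_power intro!: mult_mono power_mono)
        then show ?thesis unfolding riccati_def C_def by (simp add: norm_mult mult_left_mono)
      qed
      have "caratheodory_solution {max a (s - d)..min b (s + d)} (riccati \<kappa> A B) (\<lambda>u. \<phi> (x u))"
        using locJ unfolding local_riccati_def J by blast
      then have "norm (\<phi> (x u) - \<phi> (x s)) \<le> C * \<bar>u - s\<bar>"
        by (rule caratheodory_lipschitz) (use bnd u sJ in \<open>simp_all only: J\<close>)
      moreover have "x u \<noteq> pole" "x s \<noteq> pole" using locJ u sJ unfolding local_riccati_def by auto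
      then have Du: "D u = min 1 (norm (\<phi> (x u) - e))" "D s = min 1 (norm (\<phi> (x s) - e))"
        unfolding D_def by simp_all
      have "\<bar>norm (\<phi> (x u) - e) - norm (\<phi> (x s) - e)\<bar> \<le> norm (\<phi> (x u) - \<phi> (x s))"
        using norm_triangle_ineq3 [of "\<phi> (x u) - e" "\<phi> (x s) - e"] by simp
      then have "norm (D u - D s) \<le> norm (\<phi> (x u) - \<phi> (x s))"
        unfolding Du real_norm_def by linarith
      ultimately show ?thesis by linarith
    qed
    then show ?thesis using d(1) unfolding J_def by blast
  next
    case True
    obtain h where h: "0 < h" and \<psi>: "local_riccati \<psi> zer \<kappa> B A ({a..b} \<inter> {s - h..s + h}) x"
    proof -
      obtain h where h: "0 < h" and alt: "local_riccati \<phi> pole \<kappa> A B ({a..b} \<inter> {s - h..s + h}) x \<or>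
          local_riccati \<psi> zer \<kappa> B A ({a..b} \<inter> {s - h..s + h}) x"
        using path s unfolding two_chart_path_def by blast
      have "s \<in> {a..b} \<inter> {s - h..s + h}" using s h by auto
      then have "\<not> local_riccati \<phi> pole \<kappa> A B ({a..b} \<inter> {s - h..s + h}) x"
        using True unfolding local_riccati_def by blast
      then show thesis using that h alt by blast
    qed
    \<comment> \<open>\<open>\<bar>\<psi>\<bar> < 1 / (\<bar>e\<bar> + 1)\<close> forces \<open>\<bar>\<phi>\<bar> > \<bar>e\<bar> + 1\<close>, hence distance more than \<open>1\<close> from \<open>e\<close>.\<close>
    have "1 / (norm e + 1) > 0" by (simp add: add_nonneg_pos)
    then obtain d where d: "0 < d" "d \<le> h" and
      dd: "\<And>u. u \<in> {a..b} \<inter> {s - d..s + d} \<Longrightarrow> norm (\<psi> (x u) - \<psi> (x s)) < 1 / (norm e + 1)"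
      using local_riccati_continuous [OF \<psi> h s] by blast
    have "D u = 1" if u: "u \<in> {a..b} \<inter> {s - d..s + d}" for u
    proof (rule D1)
      assume np: "x u \<noteq> pole"
      have "x u \<noteq> zer" using \<psi> u d unfolding local_riccati_def by auto
      then have \<psi>u: "\<psi> (x u) \<noteq> 0" "\<phi> (x u) = - 1 / \<psi> (x u)" "\<psi> (x s) = 0"
        using charts np True unfolding opposite_charts_def by auto
      then have "norm (\<psi> (x u)) * (norm e + 1) < 1"
        using dd [OF u] by (simp add: pos_less_divide_eq add_nonneg_pos)
      then have "norm e + 1 \<le> norm (\<phi> (x u))"
        using \<psi>u by (simp add: norm_divide pos_le_divide_eq mult.commute)
      then show "1 \<le> norm (\<phi> (x u) - e)" using norm_triangle_ineq2 [of "\<phi> (x u)" e] by simp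
    qed
    moreover have "D s = 1" using True unfolding D_def by simp
    ultimately show ?thesis using d(1) C0 by (intro exI [of _ d]) auto
  qed
  have Dc: "D c = 0" unfolding D_def e_def using c by simp
  have close: "D s < 1" if s: "s \<in> {a..b}" for s
  proof -
    have lip: "norm (D q - D p) \<le> C * (q - p)" if pq: "p \<in> {a..b}" "q \<in> {a..b}" "p \<le> q" for p q
    proof (rule lipschitz_local [OF pq(3)])
      fix r assume r: "r \<in> {p..q}"
      then obtain h where "h > 0" "\<forall>u\<in>{a..b} \<inter> {r - h..r + h}. norm (D u - D r) \<le> C * \<bar>u - r\<bar>"
        using loc [of r] pq by auto
      then show "\<exists>h>0. \<forall>u\<in>{p..q} \<inter> {r - h..r + h}. norm (D u - D r) \<le> C * \<bar>u - r\<bar>"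
        using pq by (intro exI [of _ h]) auto
    qed
    have "norm (D s - D c) \<le> C * \<bar>s - c\<bar>"
      using lip [OF c(1) s] lip [OF s c(1)] by (cases "c \<le> s") (auto simp: abs_minus_commute)
    also have "\<dots> \<le> C * (b - a)" using C0 s c by (intro mult_left_mono) auto
    also have "\<dots> < 1" using short unfolding C_def e_def .
    finally show ?thesis using Dc by simp
  qed
  show np: "x s \<noteq> pole" if "s \<in> {a..b}" for s using close [OF that] unfolding D_def by (auto split: if_splits)
  show "norm (\<phi> (x s) - \<phi> (x c)) < 1" if "s \<in> {a..b}" for s
    using close [OF that] np [OF that] unfolding D_def e_def by auto
  show "caratheodory_solution {a..b} (riccati \<kappa> A B) (\<lambda>u. \<phi> (x u))"
  proof (rule caratheodory_local)
    fix s assume s: "s \<in> {a..b}"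
    show "\<exists>h>0. caratheodory_solution ({a..b} \<inter> {s - h..s + h}) (riccati \<kappa> A B) (\<lambda>u. \<phi> (x u))"
      using two_chart_path_at [OF path charts M s np [OF s]] unfolding local_riccati_def by metis
  qed
qed

text \<open>
  The left end \<open>s\<^sub>0\<close> is put into the exceptional null set, because controls are only constrained on
  the open half line.
\<close>
lemma feasible_regularize:
  assumes feas: "feasible n\<^sub>1 n\<^sub>2 s\<^sub>0 \<epsilon>" and n: "n\<^sub>1\<^sup>2 \<le> n\<^sub>2\<^sup>2"
  obtains \<epsilon>' N where "\<epsilon>' \<in> borel_measurable lebesgue" "\<And>s. n\<^sub>1\<^sup>2 \<le> \<epsilon>' s \<and> \<epsilon>' s \<le> n\<^sub>2\<^sup>2"
    "negligible N" "\<And>s. s\<^sub>0 \<le> s \<Longrightarrow> s \<notin> N \<Longrightarrow> \<epsilon> s = \<epsilon>' s"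
proof -
  have S: "{s\<^sub>0<..} \<in> sets lebesgue" by simp
  define \<epsilon>' where "\<epsilon>' = (\<lambda>s. max (n\<^sub>1\<^sup>2) (min (n\<^sub>2\<^sup>2) (if s \<in> {s\<^sub>0<..} then \<epsilon> s else 0)))"
  have "(\<lambda>s. if s \<in> {s\<^sub>0<..} then \<epsilon> s else 0) \<in> borel_measurable lebesgue"
    using feas borel_measurable_if [OF S, of \<epsilon>] unfolding feasible_def by blast
  then have m: "\<epsilon>' \<in> borel_measurable lebesgue" unfolding \<epsilon>'_def by measurable
  have "AE s in lebesgue_on {s\<^sub>0<..}. n\<^sub>1\<^sup>2 \<le> \<epsilon> s \<and> \<epsilon> s \<le> n\<^sub>2\<^sup>2" using feas unfolding feasible_def by blast
  then have "AE s in lebesgue. s \<in> {s\<^sub>0<..} \<longrightarrow> n\<^sub>1\<^sup>2 \<le> \<epsilon> s \<and> \<epsilon> s \<le> n\<^sub>2\<^sup>2"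
    by (subst (asm) AE_restrict_space_iff) auto
  then obtain N where N: "negligible N" "\<And>s. s \<notin> N \<Longrightarrow> s \<in> {s\<^sub>0<..} \<Longrightarrow> n\<^sub>1\<^sup>2 \<le> \<epsilon> s \<and> \<epsilon> s \<le> n\<^sub>2\<^sup>2"
    unfolding eventually_ae_filter negligible_iff_null_sets by auto
  show thesis
  proof (rule that [OF m])
    show "negligible (insert s\<^sub>0 N)" using N(1) by simp
    show "n\<^sub>1\<^sup>2 \<le> \<epsilon>' s \<and> \<epsilon>' s \<le> n\<^sub>2\<^sup>2" for s using n unfolding \<epsilon>'_def by auto
    show "\<epsilon> s = \<epsilon>' s" if "s\<^sub>0 \<le> s" "s \<notin> insert s\<^sub>0 N" for s
      using N(2) [of s] that unfolding \<epsilon>'_def by auto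
  qed
qed

lemma steers_two_chart_path:
  assumes st: "steers n\<^sub>1 n\<^sub>2 s\<^sub>0 \<kappa> T p q" and n: "n\<^sub>1\<^sup>2 \<le> n\<^sub>2\<^sup>2"
  obtains \<epsilon> x where "\<epsilon> \<in> borel_measurable lebesgue" "\<And>s. n\<^sub>1\<^sup>2 \<le> \<epsilon> s \<and> \<epsilon> s \<le> n\<^sub>2\<^sup>2"
    "x s\<^sub>0 = p" "x (s\<^sub>0 + T) = q"
    "two_chart_path the infty chart_infty (fin 0) \<kappa> (\<lambda>u. complex_of_real (\<epsilon> u)) (\<lambda>u. - 1) s\<^sub>0 (s\<^sub>0 + T) x"
    "two_chart_path chart_infty (fin 0) the infty \<kappa> (\<lambda>u. - 1) (\<lambda>u. complex_of_real (\<epsilon> u)) s\<^sub>0 (s\<^sub>0 + T) x"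
proof -
  obtain \<epsilon>0 x where f: "feasible n\<^sub>1 n\<^sub>2 s\<^sub>0 \<epsilon>0" and tr: "trajectory \<kappa> \<epsilon>0 s\<^sub>0 (s\<^sub>0 + T) x"
    and x: "x s\<^sub>0 = p" "x (s\<^sub>0 + T) = q"
    using st unfolding steers_def by blast
  obtain \<epsilon> N where \<epsilon>: "\<epsilon> \<in> borel_measurable lebesgue" "\<And>s. n\<^sub>1\<^sup>2 \<le> \<epsilon> s \<and> \<epsilon> s \<le> n\<^sub>2\<^sup>2"
    and N: "negligible N" "\<And>s. s\<^sub>0 \<le> s \<Longrightarrow> s \<notin> N \<Longrightarrow> \<epsilon>0 s = \<epsilon> s"
    by (rule feasible_regularize [OF f n]) blast
  have alt: "\<exists>h>0. local_riccati the infty \<kappa> (\<lambda>u. complex_of_real (\<epsilon> u)) (\<lambda>u. - 1) ({s\<^sub>0..s\<^sub>0 + T} \<inter> {s - h..s + h}) x \<or>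
      local_riccati chart_infty (fin 0) \<kappa> (\<lambda>u. - 1) (\<lambda>u. complex_of_real (\<epsilon> u)) ({s\<^sub>0..s\<^sub>0 + T} \<inter> {s - h..s + h}) x"
    if s: "s \<in> {s\<^sub>0..s\<^sub>0 + T}" for s
  proof -
    obtain h where h: "h > 0" and a: "((\<forall>u\<in>{s\<^sub>0..s\<^sub>0 + T} \<inter> {s - h..s + h}. x u \<noteq> infty) \<and>
          caratheodory_solution ({s\<^sub>0..s\<^sub>0 + T} \<inter> {s - h..s + h})
            (\<lambda>u z. \<i> * \<kappa> * (- z\<^sup>2 + complex_of_real (\<epsilon>0 u))) (\<lambda>u. the (x u))) \<or>
        ((\<forall>u\<in>{s\<^sub>0..s\<^sub>0 + T} \<inter> {s - h..s + h}. x u \<noteq> fin 0) \<and>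
          caratheodory_solution ({s\<^sub>0..s\<^sub>0 + T} \<inter> {s - h..s + h})
            (\<lambda>u z. \<i> * \<kappa> * (- 1 + complex_of_real (\<epsilon>0 u) * z\<^sup>2)) (\<lambda>u. chart_infty (x u)))"
      using tr s unfolding trajectory_def Let_def by blast
    have int: "is_interval ({s\<^sub>0..s\<^sub>0 + T} \<inter> {s - h..s + h})"
      by (intro is_interval_Int is_interval_cc)
    show ?thesis
      using a
    proof
      assume l: "(\<forall>u\<in>{s\<^sub>0..s\<^sub>0 + T} \<inter> {s - h..s + h}. x u \<noteq> infty) \<and>
          caratheodory_solution ({s\<^sub>0..s\<^sub>0 + T} \<inter> {s - h..s + h})
            (\<lambda>u z. \<i> * \<kappa> * (- z\<^sup>2 + complex_of_real (\<epsilon>0 u))) (\<lambda>u. the (x u))"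
      have "caratheodory_solution ({s\<^sub>0..s\<^sub>0 + T} \<inter> {s - h..s + h})
         (riccati \<kappa> (\<lambda>u. complex_of_real (\<epsilon> u)) (\<lambda>u. - 1)) (\<lambda>u. the (x u))"
        by (rule caratheodory_spike [OF conjunct2 [OF l] int N(1)]) (use N(2) in \<open>auto simp: riccati_def\<close>)
      then show ?thesis using l h unfolding local_riccati_def by blast
    next
      assume l: "(\<forall>u\<in>{s\<^sub>0..s\<^sub>0 + T} \<inter> {s - h..s + h}. x u \<noteq> fin 0) \<and>
          caratheodory_solution ({s\<^sub>0..s\<^sub>0 + T} \<inter> {s - h..s + h})
            (\<lambda>u z. \<i> * \<kappa> * (- 1 + complex_of_real (\<epsilon>0 u) * z\<^sup>2)) (\<lambda>u. chart_infty (x u))"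
      have "caratheodory_solution ({s\<^sub>0..s\<^sub>0 + T} \<inter> {s - h..s + h})
         (riccati \<kappa> (\<lambda>u. - 1) (\<lambda>u. complex_of_real (\<epsilon> u))) (\<lambda>u. chart_infty (x u))"
        by (rule caratheodory_spike [OF conjunct2 [OF l] int N(1)]) (use N(2) in \<open>auto simp: riccati_def\<close>)
      then show ?thesis using l h unfolding local_riccati_def by blast
    qed
  qed
  show thesis
    by (rule that [OF \<epsilon> x]) (use alt in \<open>unfold two_chart_path_def, blast+\<close>)
qed

section \<open>The unreachable half plane\<close>

text \<open>
  Let \<open>z' = F\<close> where \<open>F\<close> differs from a drift \<open>g\<close> in a sector by at most \<open>K \<bar>z\<bar>\<close>, and let \<open>z\<close> vanish at one
  end of the interval. With \<open>G\<close> the integral of \<open>\<bar>g\<bar>\<close> and \<open>M\<close> the maximum of \<open>\<bar>z\<bar>\<close>,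
  integration from the zero gives \<open>M \<le> G + K M (b - a)\<close>, hence \<open>M \<le> 2 G\<close> on a short interval. The
  component along \<open>d\<close> of the total displacement is then at least
  \<open>c G - 2 K (b - a) G \<ge> 0\<close>. The conclusion is insensitive to the size of \<open>G\<close>, which may be zero or
  arbitrarily small; this is what covers the end points of the control range.
\<close>
lemma half_plane_drift:
  fixes z F g :: "real \<Rightarrow> complex"
  assumes ab: "a \<le> b" and F: "F integrable_on {a..b}"
    and z: "\<And>s t. a \<le> s \<Longrightarrow> s \<le> t \<Longrightarrow> t \<le> b \<Longrightarrow> z t - z s = integral {s..t} F"
    and cz: "continuous_on {a..b} z"
    and g: "(\<lambda>u. norm (g u)) integrable_on {a..b}"
    and Fg: "\<And>u. u \<in> {a..b} \<Longrightarrow> norm (F u - g u) \<le> K * norm (z u)"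
    and cone: "\<And>u. u \<in> {a..b} \<Longrightarrow> c * norm (g u) \<le> Re (cnj d * g u)"
    and d: "norm d \<le> 1" and K: "0 \<le> K"
    and short: "2 * K * (b - a) \<le> 1" "2 * K * (b - a) \<le> c"
    and rest: "z a = 0 \<or> z b = 0"
  shows "0 \<le> Re (cnj d * (z b - z a))"
proof -
  define G where "G = integral {a..b} (\<lambda>u. norm (g u))"
  have "continuous_on {a..b} (\<lambda>u. norm (z u))" by (intro continuous_intros cz)
  then obtain m where m: "m \<in> {a..b}" and mm: "\<And>u. u \<in> {a..b} \<Longrightarrow> norm (z u) \<le> norm (z m)"
    using continuous_attains_sup [of "{a..b}" "\<lambda>u. norm (z u)"] ab by auto
  define M where "M = norm (z m)"
  have zM: "norm (z u) \<le> M" if "u \<in> {a..b}" for u using mm [OF that] unfolding M_def .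
  have G0: "G \<ge> 0" unfolding G_def by (rule integral_nonneg [OF g]) auto
  have FgM: "norm (F u - g u) \<le> K * M" if "u \<in> {a..b}" for u
    using order_trans [OF Fg [OF that] mult_left_mono [OF zM [OF that] K]] .
  have FM: "norm (F u) \<le> norm (g u) + K * M" if "u \<in> {a..b}" for u
    using FgM [OF that] norm_triangle_ineq [of "g u" "F u - g u"] by simp
  have gi: "(\<lambda>u. norm (g u) + K * M) integrable_on {a..b}"
    by (intro integrable_add g) auto
  have Gi: "integral {a..b} (\<lambda>u. norm (g u) + K * M) = G + K * M * (b - a)"
    unfolding G_def using ab by (subst Henstock_Kurzweil_Integration.integral_add [OF g]) (auto simp: mult.commute)
  have inc: "norm (z t - z s) \<le> G + K * M * (b - a)" if st: "a \<le> s" "s \<le> t" "t \<le> b" for s t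
  proof -
    have "norm (z t - z s) \<le> integral {s..t} (\<lambda>u. norm (g u) + K * M)"
      unfolding z [OF st]
      by (rule integral_norm_bound_integral)
        (use st FM integrable_subinterval_real [OF F] integrable_subinterval_real [OF gi] in auto)
    also have "\<dots> \<le> integral {a..b} (\<lambda>u. norm (g u) + K * M)"
      by (rule integral_subset_le) (use st K gi integrable_subinterval_real [OF gi] in \<open>auto simp: M_def\<close>)
    finally show ?thesis unfolding Gi .
  qed
  have "M \<le> G + K * M * (b - a)"
    using rest inc [of a m] inc [of m b] m unfolding M_def by auto
  moreover have "2 * K * (b - a) * M \<le> 1 * M"
    using short by (intro mult_right_mono) (auto simp: M_def)
  ultimately have MG: "M \<le> 2 * G" by (simp add: algebra_simps)
  have ReF: "(\<lambda>u. Re (cnj d * F u)) integrable_on {a..b}"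
    using has_integral_Re [OF integrable_integral [OF integrable_on_mult_right [OF F, of "cnj d"]]] by blast
  have "Re (cnj d * (z b - z a)) = integral {a..b} (\<lambda>u. Re (cnj d * F u))"
    using has_integral_Re [OF integrable_integral [OF integrable_on_mult_right [OF F, of "cnj d"]]]
    unfolding z [OF order_refl ab order_refl] by (simp add: integral_unique del: Re_complex_of_real times_complex.sel)
  moreover have "integral {a..b} (\<lambda>u. c * norm (g u) - K * M) \<le> integral {a..b} (\<lambda>u. Re (cnj d * F u))"
  proof (rule integral_le [OF _ ReF])
    show "(\<lambda>u. c * norm (g u) - K * M) integrable_on {a..b}"
      by (intro integrable_diff integrable_on_mult_right g) auto
    fix u assume u: "u \<in> {a..b}"
    have "\<bar>Re (cnj d * (F u - g u))\<bar> \<le> norm (cnj d) * norm (F u - g u)"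
      using abs_Re_le_cmod by (metis norm_mult)
    also have "\<dots> \<le> 1 * (K * M)" using d FgM [OF u] by (intro mult_mono) auto
    finally have "- (K * M) \<le> Re (cnj d * (F u - g u))" by linarith
    moreover have "Re (cnj d * F u) = Re (cnj d * g u) + Re (cnj d * (F u - g u))"
      by (simp add: algebra_simps)
    ultimately show "c * norm (g u) - K * M \<le> Re (cnj d * F u)" using cone [OF u] by linarith
  qed
  moreover have "integral {a..b} (\<lambda>u. c * norm (g u) - K * M) = c * G - K * M * (b - a)"
    unfolding G_def using ab g
    by (subst Henstock_Kurzweil_Integration.integral_diff) (auto simp: mult.commute intro: integrable_on_mult_right)
  moreover have "K * M * (b - a) \<le> c * G"
  proof -
    have "K * (b - a) * M \<le> K * (b - a) * (2 * G)" using MG K ab by (intro mult_left_mono) auto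
    also have "\<dots> = 2 * K * (b - a) * G" by simp
    also have "\<dots> \<le> c * G" using short G0 by (intro mult_right_mono) auto
    finally show ?thesis by (simp add: algebra_simps)
  qed
  ultimately show ?thesis by linarith
qed

lemma two_chart_path_half_plane:
  assumes ab: "a \<le> b"
    and path: "two_chart_path \<phi> pole \<psi> zer \<kappa> A B a b x"
    and charts: "opposite_charts \<phi> pole \<psi> zer"
    and M: "\<And>u. norm (A u) \<le> M" "\<And>u. norm (B u) \<le> M"
    and rest: "x a = \<eta> \<or> x b = \<eta>" and \<eta>: "\<eta> \<noteq> pole"
    and g: "(\<lambda>u. norm (g u)) integrable_on {a..b}"
    and drift: "\<And>u z. norm (z - \<phi> \<eta>) \<le> 1 \<Longrightarrow> norm (riccati \<kappa> A B u z - g u) \<le> K * norm (z - \<phi> \<eta>)"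
    and cone: "\<And>u. c * norm (g u) \<le> Re (cnj d * g u)"
    and d: "norm d \<le> 1" and K: "0 \<le> K"
    and short: "norm \<kappa> * (M + M * (norm (\<phi> \<eta>) + 2)\<^sup>2) * (b - a) < 1"
      "2 * K * (b - a) \<le> 1" "2 * K * (b - a) \<le> c"
  shows "0 \<le> Re (cnj d * (\<phi> (x b) - \<phi> (x a)))"
proof -
  obtain m where m: "m \<in> {a..b}" "x m = \<eta>" using rest ab by auto
  note conf = two_chart_path_confined [OF path charts M m(1), unfolded m(2), OF \<eta> short(1)]
  have car: "(\<lambda>u. riccati \<kappa> A B u (\<phi> (x u))) integrable_on {s..t}"
    "\<phi> (x t) - \<phi> (x s) = integral {s..t} (\<lambda>u. riccati \<kappa> A B u (\<phi> (x u)))" if "a \<le> s" "s \<le> t" "t \<le> b" for s t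
    using conf(2) that unfolding caratheodory_solution_def
    by (auto intro: set_lebesgue_integral_eq_integral(1))
  have "0 \<le> Re (cnj d * ((\<phi> (x b) - \<phi> \<eta>) - (\<phi> (x a) - \<phi> \<eta>)))"
  proof (rule half_plane_drift [where F = "\<lambda>u. riccati \<kappa> A B u (\<phi> (x u))" and z = "\<lambda>u. \<phi> (x u) - \<phi> \<eta>" and g = g and K = K and c = c])
    show "continuous_on {a..b} (\<lambda>u. \<phi> (x u) - \<phi> \<eta>)"
      by (intro continuous_intros caratheodory_continuous [OF conf(2)])
    show "norm (riccati \<kappa> A B u (\<phi> (x u)) - g u) \<le> K * norm (\<phi> (x u) - \<phi> \<eta>)" if "u \<in> {a..b}" for u
      using drift [of "\<phi> (x u)" u] conf(1) [OF that] by simp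
  qed (use ab car g cone d K short rest in auto)
  then show "0 \<le> Re (cnj d * (\<phi> (x b) - \<phi> (x a)))" by simp
qed

lemma short_time:
  fixes C K c :: real
  assumes "0 \<le> C" "0 \<le> K" "0 < c"
  obtains t where "0 < t" "\<And>T. 0 \<le> T \<Longrightarrow> T < t \<Longrightarrow> C * T < 1 \<and> 2 * K * T \<le> 1 \<and> 2 * K * T \<le> c"
proof -
  define N where "N = C + 2 * K + 1"
  have N: "N > 0" "C \<le> N" "2 * K \<le> N" unfolding N_def using assms by auto
  show thesis
  proof (rule that [of "min 1 c / N"])
    show "0 < min 1 c / N" using N assms by simp
    fix T assume T: "0 \<le> T" "T < min 1 c / N"
    then have NT: "N * T < min 1 c" using N by (simp add: pos_less_divide_eq mult.commute)
    have "C * T \<le> N * T" "2 * K * T \<le> N * T" using N T by (auto intro!: mult_right_mono)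
    then show "C * T < 1 \<and> 2 * K * T \<le> 1 \<and> 2 * K * T \<le> c" using NT by linarith
  qed
qed

lemma Re_of_real_times: "Re (complex_of_real r * w) = r * Re w"
  by simp

text \<open>
  If \<open>w\<close> is real and outside the open segment, all differences have one sign. If \<open>w\<close> is not real, they
  have the same nonzero imaginary part and are bounded.
\<close>
lemma segment_in_sector:
  fixes w :: complex
  assumes "w \<notin> complex_of_real ` {lo<..<hi}"
  obtains c d where "0 < c" "norm d = 1"
    "\<And>v. lo \<le> v \<Longrightarrow> v \<le> hi \<Longrightarrow> c * norm (complex_of_real v - w) \<le> Re (cnj d * (complex_of_real v - w))"
proof (cases "Im w = 0")
  case True
  then have w: "w = complex_of_real (Re w)" by (simp add: complex_eq_iff)
  have n: "norm (complex_of_real v - w) = \<bar>v - Re w\<bar>" for v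
    by (subst w) (simp only: of_real_diff [symmetric] norm_of_real)
  have "Re w \<le> lo \<or> hi \<le> Re w" using assms w by (metis greaterThanLessThan_iff imageI not_le)
  then show thesis
  proof
    assume "Re w \<le> lo"
    then show thesis by (intro that [of 1 1]) (auto simp: n)
  next
    assume "hi \<le> Re w"
    then show thesis by (intro that [of 1 "-1"]) (auto simp: n)
  qed
next
  case False
  define N where "N = \<bar>lo\<bar> + \<bar>hi\<bar> + norm w"
  have N: "N > 0" unfolding N_def using False by (auto intro!: add_nonneg_pos)
  show thesis
  proof (rule that [of "\<bar>Im w\<bar> / N" "- \<i> * complex_of_real (sgn (Im w))"])
    show "0 < \<bar>Im w\<bar> / N" using False N by simp
    show "norm (- \<i> * complex_of_real (sgn (Im w))) = 1" using False by (simp add: norm_mult abs_sgn_eq)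
    fix v assume v: "lo \<le> v" "v \<le> hi"
    have "norm (complex_of_real v - w) \<le> N"
      using norm_triangle_ineq4 [of "complex_of_real v" w] v unfolding N_def norm_of_real by linarith
    then have "\<bar>Im w\<bar> / N * norm (complex_of_real v - w) \<le> \<bar>Im w\<bar> / N * N"
      using N by (intro mult_left_mono) auto
    also have "\<dots> = Re (cnj (- \<i> * complex_of_real (sgn (Im w))) * (complex_of_real v - w))"
      using N by (simp add: abs_sgn mult.commute)
    finally show "\<bar>Im w\<bar> / N * norm (complex_of_real v - w)
        \<le> Re (cnj (- \<i> * complex_of_real (sgn (Im w))) * (complex_of_real v - w))" .
  qed
qed

text \<open>
  With \<open>z = x - \<eta>\<close> the velocity is \<open>g - \<i> \<kappa> (x + \<eta>) z\<close>, where \<open>g = \<i> \<kappa> (\<epsilon> - \<eta>\<^sup>2)\<close> lies in the sector of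
  \<open>segment_in_sector\<close>, rotated by the unit number \<open>\<i> \<kappa> / \<bar>\<kappa>\<bar>\<close>.
\<close>
lemma half_plane_obstruction_finite:
  fixes \<eta> \<kappa> :: complex
  assumes n: "n\<^sub>1\<^sup>2 \<le> n\<^sub>2\<^sup>2" and \<kappa>: "\<kappa> \<noteq> 0" and \<eta>: "\<eta>\<^sup>2 \<notin> complex_of_real ` {n\<^sub>1\<^sup>2<..<n\<^sub>2\<^sup>2}"
  obtains t d where "0 < t" "d \<noteq> 0"
    "\<And>T p q. \<lbrakk>0 \<le> T; T < t; steers n\<^sub>1 n\<^sub>2 s\<^sub>0 \<kappa> T p q; p = fin \<eta> \<or> q = fin \<eta>\<rbrakk> \<Longrightarrow>
       0 \<le> Re (cnj d * (the q - the p))"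
proof -
  obtain c d where c: "0 < c" and d: "norm d = 1"
    and cone: "\<And>v. n\<^sub>1\<^sup>2 \<le> v \<Longrightarrow> v \<le> n\<^sub>2\<^sup>2 \<Longrightarrow> c * norm (complex_of_real v - \<eta>\<^sup>2) \<le> Re (cnj d * (complex_of_real v - \<eta>\<^sup>2))"
    using segment_in_sector [OF \<eta>] by metis
  define M where "M = n\<^sub>2\<^sup>2 + 1"
  define K where "K = norm \<kappa> * (2 * norm \<eta> + 1)"
  define e where "e = \<i> * \<kappa> * d / norm \<kappa>"
  have M0: "M \<ge> 0" unfolding M_def by (simp add: add_nonneg_nonneg)
  have K0: "K \<ge> 0" unfolding K_def by simp
  obtain t where t: "0 < t" and short: "\<And>T. 0 \<le> T \<Longrightarrow> T < t \<Longrightarrow>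
      norm \<kappa> * (M + M * (norm \<eta> + 2)\<^sup>2) * T < 1 \<and> 2 * K * T \<le> 1 \<and> 2 * K * T \<le> c"
    by (rule short_time [of "norm \<kappa> * (M + M * (norm \<eta> + 2)\<^sup>2)" K c]) (use M0 K0 c in auto)
  have e1: "norm e = 1" unfolding e_def using \<kappa> d by (simp add: norm_mult norm_divide)
  show thesis
  proof (rule that [OF t, of e])
    show "e \<noteq> 0" using e1 by auto
  next
    fix T p q
    assume T: "0 \<le> T" "T < t" and st: "steers n\<^sub>1 n\<^sub>2 s\<^sub>0 \<kappa> T p q" and pq: "p = fin \<eta> \<or> q = fin \<eta>"
    obtain \<epsilon> x where \<epsilon>: "\<epsilon> \<in> borel_measurable lebesgue" "\<And>s. n\<^sub>1\<^sup>2 \<le> \<epsilon> s \<and> \<epsilon> s \<le> n\<^sub>2\<^sup>2"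
      and x: "x s\<^sub>0 = p" "x (s\<^sub>0 + T) = q"
      and path: "two_chart_path the infty chart_infty (fin 0) \<kappa> (\<lambda>u. complex_of_real (\<epsilon> u)) (\<lambda>u. - 1) s\<^sub>0 (s\<^sub>0 + T) x"
      by (rule steers_two_chart_path [OF st n]) blast
    define g where "g = (\<lambda>u. \<i> * \<kappa> * (complex_of_real (\<epsilon> u) - \<eta>\<^sup>2))"
    have \<epsilon>b: "\<bar>\<epsilon> u\<bar> \<le> n\<^sub>2\<^sup>2" for u using \<epsilon>(2) [of u] zero_le_power2 [of n\<^sub>1] by linarith
    have gint: "(\<lambda>u. norm (g u)) integrable_on {s\<^sub>0..s\<^sub>0 + T}"
    proof (rule measurable_bounded_by_integrable_imp_integrable)
      have "(\<lambda>u. norm (g u)) \<in> borel_measurable lebesgue" unfolding g_def using \<epsilon>(1) by measurable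
      then show "(\<lambda>u. norm (g u)) \<in> borel_measurable (lebesgue_on {s\<^sub>0..s\<^sub>0 + T})"
        by (rule measurable_restrict_space1)
      show "(\<lambda>u. norm \<kappa> * (n\<^sub>2\<^sup>2 + norm (\<eta>\<^sup>2))) integrable_on {s\<^sub>0..s\<^sub>0 + T}" by auto
      fix u
      have "norm (complex_of_real (\<epsilon> u) - \<eta>\<^sup>2) \<le> n\<^sub>2\<^sup>2 + norm (\<eta>\<^sup>2)"
        using norm_triangle_ineq4 [of "complex_of_real (\<epsilon> u)" "\<eta>\<^sup>2"] \<epsilon>b [of u] unfolding norm_of_real by linarith
      then show "norm (norm (g u)) \<le> norm \<kappa> * (n\<^sub>2\<^sup>2 + norm (\<eta>\<^sup>2))"
        unfolding g_def by (simp add: norm_mult mult_left_mono)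
    qed auto
    have "0 \<le> Re (cnj e * (the (x (s\<^sub>0 + T)) - the (x s\<^sub>0)))"
    proof (rule two_chart_path_half_plane
        [where \<eta> = "fin \<eta>" and g = g and M = M and K = K and c = c, OF _ path opposite_charts_standard(1)])
      show "norm (complex_of_real (\<epsilon> u)) \<le> M" for u using \<epsilon>b [of u] unfolding M_def by simp
      show "norm (- 1 :: complex) \<le> M" unfolding M_def by simp
      show "c * norm (g u) \<le> Re (cnj e * g u)" for u
      proof -
        have eg: "cnj e * g u = complex_of_real (norm \<kappa>) * (cnj d * (complex_of_real (\<epsilon> u) - \<eta>\<^sup>2))"
        proof -
          have "cnj e * g u = (\<kappa> * cnj \<kappa>) * (cnj d * (complex_of_real (\<epsilon> u) - \<eta>\<^sup>2)) / norm \<kappa>"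
            unfolding e_def g_def by (simp add: algebra_simps diff_divide_distrib)
          then show ?thesis using \<kappa> unfolding complex_norm_square [symmetric] by (simp add: power2_eq_square)
        qed
        have "c * norm (g u) = norm \<kappa> * (c * norm (complex_of_real (\<epsilon> u) - \<eta>\<^sup>2))"
          unfolding g_def by (simp add: norm_mult)
        also have "\<dots> \<le> norm \<kappa> * Re (cnj d * (complex_of_real (\<epsilon> u) - \<eta>\<^sup>2))"
          by (rule mult_left_mono [OF cone]) (use \<epsilon>(2) [of u] in auto)
        also have "\<dots> = Re (cnj e * g u)"
          unfolding eg by (rule Re_of_real_times [symmetric])
        finally show ?thesis .
      qed
      show "norm (riccati \<kappa> (\<lambda>u. complex_of_real (\<epsilon> u)) (\<lambda>u. - 1) u z - g u) \<le> K * norm (z - the (fin \<eta>))"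
        if z: "norm (z - the (fin \<eta>)) \<le> 1" for u z
      proof -
        have "riccati \<kappa> (\<lambda>u. complex_of_real (\<epsilon> u)) (\<lambda>u. - 1) u z - g u = - \<i> * \<kappa> * (z + \<eta>) * (z - \<eta>)"
          unfolding riccati_def g_def by (simp add: algebra_simps power2_eq_square)
        moreover have "norm (z + \<eta>) \<le> 2 * norm \<eta> + 1"
          using norm_triangle_ineq [of "z - \<eta>" "2 * \<eta>"] z by (simp add: norm_mult add.commute)
        ultimately show ?thesis unfolding K_def by (simp add: norm_mult mult_left_mono mult_right_mono)
      qed
    qed (use T x pq gint e1 K0 short [OF T] in auto)
    then show "0 \<le> Re (cnj e * (the q - the p))" unfolding x .
  qed
qed

text \<open>
  At infinity the drift \<open>- \<i> \<kappa>\<close> is a nonzero constant and spans its own sector.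
\<close>
lemma half_plane_obstruction_infinity:
  fixes \<kappa> :: complex
  assumes n: "n\<^sub>1\<^sup>2 \<le> n\<^sub>2\<^sup>2" and \<kappa>: "\<kappa> \<noteq> 0"
  obtains t d where "0 < t" "d \<noteq> 0"
    "\<And>T p q. \<lbrakk>0 \<le> T; T < t; steers n\<^sub>1 n\<^sub>2 s\<^sub>0 \<kappa> T p q; p = infty \<or> q = infty\<rbrakk> \<Longrightarrow>
       0 \<le> Re (cnj d * (chart_infty q - chart_infty p))"
proof -
  define M where "M = n\<^sub>2\<^sup>2 + 1"
  define K where "K = norm \<kappa> * n\<^sub>2\<^sup>2"
  define e where "e = - \<i> * \<kappa> / norm \<kappa>"
  have M0: "M \<ge> 0" unfolding M_def by (simp add: add_nonneg_nonneg)
  have K0: "K \<ge> 0" unfolding K_def by simp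
  obtain t where t: "0 < t" and short: "\<And>T. 0 \<le> T \<Longrightarrow> T < t \<Longrightarrow>
      norm \<kappa> * (M + M * 2\<^sup>2) * T < 1 \<and> 2 * K * T \<le> 1 \<and> 2 * K * T \<le> 1"
    by (rule short_time [of "norm \<kappa> * (M + M * 2\<^sup>2)" K 1]) (use M0 K0 in auto)
  have e1: "norm e = 1" unfolding e_def using \<kappa> by (simp add: norm_mult norm_divide)
  show thesis
  proof (rule that [OF t, of e])
    show "e \<noteq> 0" using e1 by auto
  next
    fix T p q
    assume T: "0 \<le> T" "T < t" and st: "steers n\<^sub>1 n\<^sub>2 s\<^sub>0 \<kappa> T p q" and pq: "p = infty \<or> q = infty"
    obtain \<epsilon> x where \<epsilon>: "\<And>s. n\<^sub>1\<^sup>2 \<le> \<epsilon> s \<and> \<epsilon> s \<le> n\<^sub>2\<^sup>2"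
      and x: "x s\<^sub>0 = p" "x (s\<^sub>0 + T) = q"
      and path: "two_chart_path chart_infty (fin 0) the infty \<kappa> (\<lambda>u. - 1) (\<lambda>u. complex_of_real (\<epsilon> u)) s\<^sub>0 (s\<^sub>0 + T) x"
      by (rule steers_two_chart_path [OF st n]) blast
    have \<epsilon>b: "\<bar>\<epsilon> u\<bar> \<le> n\<^sub>2\<^sup>2" for u using \<epsilon> [of u] zero_le_power2 [of n\<^sub>1] by linarith
    have "0 \<le> Re (cnj e * (chart_infty (x (s\<^sub>0 + T)) - chart_infty (x s\<^sub>0)))"
    proof (rule two_chart_path_half_plane
        [where \<eta> = infty and g = "\<lambda>_. - \<i> * \<kappa>" and M = M and K = K and c = 1, OF _ path opposite_charts_standard(2)])
      show "norm (complex_of_real (\<epsilon> u)) \<le> M" for u using \<epsilon>b [of u] unfolding M_def by simp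
      show "norm (- 1 :: complex) \<le> M" unfolding M_def by simp
      show "1 * norm (- \<i> * \<kappa>) \<le> Re (cnj e * (- \<i> * \<kappa>))"
      proof -
        have "cnj e * (- \<i> * \<kappa>) = (\<kappa> * cnj \<kappa>) / norm \<kappa>" unfolding e_def by (simp add: algebra_simps)
        also have "\<dots> = complex_of_real (norm \<kappa>)"
          using \<kappa> unfolding complex_norm_square [symmetric] by (simp add: power2_eq_square)
        finally show ?thesis by (simp add: norm_mult)
      qed
      show "norm (riccati \<kappa> (\<lambda>u. - 1) (\<lambda>u. complex_of_real (\<epsilon> u)) u z - (- \<i> * \<kappa>)) \<le> K * norm (z - chart_infty infty)"
        if z: "norm (z - chart_infty infty) \<le> 1" for u z
      proof -
        have "riccati \<kappa> (\<lambda>u. - 1) (\<lambda>u. complex_of_real (\<epsilon> u)) u z - (- \<i> * \<kappa>) = \<i> * \<kappa> * complex_of_real (\<epsilon> u) * z * z"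
          unfolding riccati_def by (simp add: algebra_simps power2_eq_square)
        then have "norm (riccati \<kappa> (\<lambda>u. - 1) (\<lambda>u. complex_of_real (\<epsilon> u)) u z - (- \<i> * \<kappa>))
            = norm \<kappa> * \<bar>\<epsilon> u\<bar> * norm z * norm z" by (simp add: norm_mult)
        also have "\<dots> \<le> norm \<kappa> * n\<^sub>2\<^sup>2 * 1 * norm z"
          using z \<epsilon>b [of u] by (intro mult_mono) auto
        finally show ?thesis unfolding K_def by simp
      qed
    qed (use T x pq e1 K0 short [OF T] in auto)
    then show "0 \<le> Re (cnj e * (chart_infty q - chart_infty p))" unfolding x .
  qed
qed

text \<open>
  The points displaced from \<open>\<eta>\<close> by small multiples of \<open>d\<close> would have to move against the half plane
  in order to reach \<open>\<eta>\<close>, and those displaced by multiples of \<open>- d\<close> in order to be reached. The time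
  bound \<open>t\<close> does not depend on the radius \<open>r\<close>; this is what defeats every disc.
\<close>
lemma uncontrollable_points:
  assumes n: "0 < n\<^sub>1" "n\<^sub>1 < n\<^sub>2" and \<kappa>: "\<kappa> \<noteq> 0"
    and \<eta>: "\<eta> \<notin> (\<lambda>y. fin (complex_of_real y)) ` ({- n\<^sub>2<..<- n\<^sub>1} \<union> {n\<^sub>1<..<n\<^sub>2})"
  obtains t where "0 < t"
    "\<And>r. 0 < r \<Longrightarrow> \<exists>p\<in>disc \<eta> r. \<forall>T\<in>{0..<t}. \<not> steers n\<^sub>1 n\<^sub>2 s\<^sub>0 \<kappa> T p \<eta>"
    "\<And>r. 0 < r \<Longrightarrow> \<exists>q\<in>disc \<eta> r. \<forall>T\<in>{0..<t}. \<not> steers n\<^sub>1 n\<^sub>2 s\<^sub>0 \<kappa> T \<eta> q"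
proof -
  have n2: "n\<^sub>1\<^sup>2 \<le> n\<^sub>2\<^sup>2" using n by (intro power_mono) auto
  have neg: "Re (cnj d * (- (complex_of_real a * d))) < 0" if "0 < a" "d \<noteq> 0" for a d
  proof -
    have "cnj d * (- (complex_of_real a * d)) = complex_of_real (- (a * (norm d)\<^sup>2))"
      unfolding of_real_minus of_real_mult complex_norm_square by (simp add: algebra_simps)
    then have "Re (cnj d * (- (complex_of_real a * d))) = - (a * (norm d)\<^sup>2)"
      by (metis Re_complex_of_real)
    also have "\<dots> < 0" using that by simp
    finally show ?thesis .
  qed
  show thesis
  proof (cases \<eta>)
    case (Some h)
    have "h\<^sup>2 \<notin> complex_of_real ` {n\<^sub>1\<^sup>2<..<n\<^sub>2\<^sup>2}"
    proof
      assume "h\<^sup>2 \<in> complex_of_real ` {n\<^sub>1\<^sup>2<..<n\<^sub>2\<^sup>2}"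
      then obtain v where v: "n\<^sub>1\<^sup>2 < v" "v < n\<^sub>2\<^sup>2" "h\<^sup>2 = complex_of_real v" by auto
      define y where "y = sqrt v"
      have v0: "v > 0" using v(1) zero_le_power2 [of n\<^sub>1] by linarith
      have y: "n\<^sub>1 < y" "y < n\<^sub>2"
        unfolding y_def using v n by (auto intro: real_less_rsqrt real_less_lsqrt)
      have "h\<^sup>2 = (complex_of_real y)\<^sup>2"
        using v(3) v0 unfolding y_def of_real_power [symmetric] by simp
      then have "h = complex_of_real y \<or> h = complex_of_real (- y)" by (auto simp: power2_eq_iff)
      then show False using \<eta> y unfolding Some by (auto simp: image_iff)
    qed
    from half_plane_obstruction_finite [OF n2 \<kappa> this] obtain t d where t: "0 < t" and d: "d \<noteq> 0"
      and ob: "\<And>T p q. \<lbrakk>0 \<le> T; T < t; steers n\<^sub>1 n\<^sub>2 s\<^sub>0 \<kappa> T p q; p = fin h \<or> q = fin h\<rbrakk> \<Longrightarrow>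
       0 \<le> Re (cnj d * (the q - the p))" by metis
    show thesis
    proof (rule that [OF t])
      fix r :: real assume r: "0 < r"
      define a where "a = r / (2 * norm d)"
      have a: "a > 0" "norm (complex_of_real a * d) < r"
        unfolding norm_mult norm_of_real a_def using r d by simp_all
      show "\<exists>p\<in>disc \<eta> r. \<forall>T\<in>{0..<t}. \<not> steers n\<^sub>1 n\<^sub>2 s\<^sub>0 \<kappa> T p \<eta>"
      proof (intro bexI ballI notI)
        show "fin (h + complex_of_real a * d) \<in> disc \<eta> r" unfolding Some using a by (simp add: dist_norm)
        fix T assume "T \<in> {0..<t}" "steers n\<^sub>1 n\<^sub>2 s\<^sub>0 \<kappa> T (fin (h + complex_of_real a * d)) \<eta>"
        then show False using ob [of T "fin (h + complex_of_real a * d)" \<eta>] neg [OF a(1) d] unfolding Some by simp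
      qed
      show "\<exists>q\<in>disc \<eta> r. \<forall>T\<in>{0..<t}. \<not> steers n\<^sub>1 n\<^sub>2 s\<^sub>0 \<kappa> T \<eta> q"
      proof (intro bexI ballI notI)
        show "fin (h - complex_of_real a * d) \<in> disc \<eta> r" unfolding Some using a by (simp add: dist_norm)
        fix T assume "T \<in> {0..<t}" "steers n\<^sub>1 n\<^sub>2 s\<^sub>0 \<kappa> T \<eta> (fin (h - complex_of_real a * d))"
        then show False using ob [of T \<eta> "fin (h - complex_of_real a * d)"] neg [OF a(1) d] unfolding Some by simp
      qed
    qed
  next
    case None
    from half_plane_obstruction_infinity [OF n2 \<kappa>] obtain t d where t: "0 < t" and d: "d \<noteq> 0"
      and ob: "\<And>T p q. \<lbrakk>0 \<le> T; T < t; steers n\<^sub>1 n\<^sub>2 s\<^sub>0 \<kappa> T p q; p = infty \<or> q = infty\<rbrakk> \<Longrightarrow>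
       0 \<le> Re (cnj d * (chart_infty q - chart_infty p))" by metis
    show thesis
    proof (rule that [OF t])
      fix r :: real assume r: "0 < r"
      define a where "a = r / (2 * norm d)"
      have a: "a > 0" "norm (complex_of_real a * d) < r"
        unfolding norm_mult norm_of_real a_def using r d by simp_all
      define w where "w = complex_of_real a * d"
      have w: "w \<noteq> 0" "norm w < r" using a d unfolding w_def by auto
      show "\<exists>p\<in>disc \<eta> r. \<forall>T\<in>{0..<t}. \<not> steers n\<^sub>1 n\<^sub>2 s\<^sub>0 \<kappa> T p \<eta>"
      proof (intro bexI ballI notI)
        show "fin (- 1 / w) \<in> disc \<eta> r" unfolding None using w by simp
        fix T assume "T \<in> {0..<t}" "steers n\<^sub>1 n\<^sub>2 s\<^sub>0 \<kappa> T (fin (- 1 / w)) \<eta>"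
        then show False using ob [of T "fin (- 1 / w)" \<eta>] neg [OF a(1) d] w(1) unfolding None w_def by simp
      qed
      show "\<exists>q\<in>disc \<eta> r. \<forall>T\<in>{0..<t}. \<not> steers n\<^sub>1 n\<^sub>2 s\<^sub>0 \<kappa> T \<eta> q"
      proof (intro bexI ballI notI)
        show "fin (1 / w) \<in> disc \<eta> r" unfolding None using w by simp
        fix T assume "T \<in> {0..<t}" "steers n\<^sub>1 n\<^sub>2 s\<^sub>0 \<kappa> T \<eta> (fin (1 / w))"
        then show False using ob [of T \<eta> "fin (1 / w)"] neg [OF a(1) d] w(1) unfolding None w_def by simp
      qed
    qed
  qed
qed

text \<open>
  At time \<open>0\<close> the set \<open>A \<kappa> 0\<close> may be empty, as no time lies in \<open>[0, 0)\<close>; the radius \<open>c t\<^sup>2\<close> then gives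
  the empty disc.
\<close>
lemma uniform_disc_boundI:
  assumes c: "0 < c"
    and sub: "\<And>\<kappa> t. \<kappa> \<in> \<Omega> \<Longrightarrow> 0 < t \<Longrightarrow> t < 1 \<Longrightarrow> disc (fin z) (c * t\<^sup>2) \<subseteq> A \<kappa> t"
  shows "uniform_disc_bound (fin z) A \<Omega>"
  unfolding uniform_disc_bound_def
proof (intro exI [of _ 1] exI [of _ "\<lambda>t. c * t\<^sup>2"] conjI ballI)
  show "strict_mono_on {0..<1} (\<lambda>t. c * t\<^sup>2)"
    using c by (auto intro!: strict_mono_onI power_strict_mono)
  show "continuous_on {0..<1} (\<lambda>t. c * t\<^sup>2)" by (intro continuous_intros)
  show "0 \<le> c * t\<^sup>2" for t using c by simp
  fix \<kappa> t assume k: "\<kappa> \<in> \<Omega>" and t: "t \<in> {0..<1::real}"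
  have "disc (fin z) (c * t\<^sup>2) \<subseteq> A \<kappa> t"
    using sub [OF k, of t] t by (cases "t = 0") auto
  then show "ereal (c * t\<^sup>2) \<le> r_max (fin z) (A \<kappa> t)"
    unfolding r_max_def using c by (intro Sup_upper) auto
qed simp

lemma uniform_disc_boundD:
  assumes u: "uniform_disc_bound \<eta> A \<Omega>" and k: "\<kappa> \<in> \<Omega>" and t1: "0 < t1"
  obtains t r where "0 < t" "t < t1" "0 < r" "disc \<eta> r \<subseteq> A \<kappa> t"
proof -
  obtain \<delta> \<rho> where \<delta>: "\<delta> > 0" and \<rho>: "strict_mono_on {0..<\<delta>} \<rho>" "\<forall>t\<in>{0..<\<delta>}. 0 \<le> \<rho> t"
    and b: "\<forall>\<kappa>\<in>\<Omega>. \<forall>t\<in>{0..<\<delta>}. ereal (\<rho> t) \<le> r_max \<eta> (A \<kappa> t)"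
    using u unfolding uniform_disc_bound_def by blast
  define t where "t = min \<delta> t1 / 2"
  have t: "0 < t" "t < t1" "t \<in> {0..<\<delta>}" unfolding t_def using \<delta> t1 by auto
  have "\<rho> 0 < \<rho> t" using strict_mono_onD [OF \<rho>(1), of 0 t] t \<delta> by simp
  then have "0 < \<rho> t" using \<rho>(2) \<delta> by (metis atLeastLessThan_iff order_refl order_le_less_trans)
  then have "0 < r_max \<eta> (A \<kappa> t)"
    using b k t(3) by (metis ereal_less(2) less_le_trans)
  then obtain r where "0 < r" "disc \<eta> r \<subseteq> A \<kappa> t"
    unfolding r_max_def less_Sup_iff by auto
  then show thesis using that t by blast
qed

theorem theorem4p4:
  fixes n\<^sub>1 n\<^sub>2 s\<^sub>0 :: real and \<kappa>\<^sub>0 :: complex and \<eta> :: csphere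
  assumes "0 < n\<^sub>1" and "n\<^sub>1 < n\<^sub>2"
    and "\<kappa>\<^sub>0 \<notin> {\<i> * complex_of_real y | y. True}"
  shows "((\<exists>\<delta>>0. stlc_to n\<^sub>1 n\<^sub>2 s\<^sub>0 \<eta> (ball \<kappa>\<^sub>0 \<delta>)) \<longleftrightarrow>
           \<eta> \<in> (\<lambda>y. fin (complex_of_real y)) ` ({- n\<^sub>2<..<- n\<^sub>1} \<union> {n\<^sub>1<..<n\<^sub>2})) \<and>
         ((\<exists>\<delta>>0. stlc_from n\<^sub>1 n\<^sub>2 s\<^sub>0 \<eta> (ball \<kappa>\<^sub>0 \<delta>)) \<longleftrightarrow>
           \<eta> \<in> (\<lambda>y. fin (complex_of_real y)) ` ({- n\<^sub>2<..<- n\<^sub>1} \<union> {n\<^sub>1<..<n\<^sub>2}))"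
    (is "(?to \<longleftrightarrow> ?in) \<and> (?from \<longleftrightarrow> ?in)")
proof -
  have k0: "Re \<kappa>\<^sub>0 \<noteq> 0"
  proof
    assume "Re \<kappa>\<^sub>0 = 0"
    then have "\<kappa>\<^sub>0 = \<i> * complex_of_real (Im \<kappa>\<^sub>0)" by (simp add: complex_eq_iff)
    then show False using assms(3) by blast
  qed
  then have \<kappa>: "\<kappa>\<^sub>0 \<noteq> 0" by auto
  have sufficient: "?to \<and> ?from" if target: ?in
  proof -
    obtain y where \<eta>: "\<eta> = fin (complex_of_real y)" and y: "y \<in> {- n\<^sub>2<..<- n\<^sub>1} \<union> {n\<^sub>1<..<n\<^sub>2}"
      using target by blast
    have "n\<^sub>1 < \<bar>y\<bar>" "\<bar>y\<bar> < n\<^sub>2" using y assms by auto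
    then have "n\<^sub>1\<^sup>2 < \<bar>y\<bar>\<^sup>2" "\<bar>y\<bar>\<^sup>2 < n\<^sub>2\<^sup>2" 
      using assms power_strict_mono [of n\<^sub>1 "\<bar>y\<bar>" 2] power_strict_mono [of "\<bar>y\<bar>" n\<^sub>2 2]
      by (simp_all del: power2_abs)
    then have y2: "y \<noteq> 0" "n\<^sub>1\<^sup>2 < y\<^sup>2" "y\<^sup>2 < n\<^sub>2\<^sup>2" using \<open>n\<^sub>1 < \<bar>y\<bar>\<close> assms by auto
    obtain \<delta> c where \<delta>: "\<delta> > 0" and c: "c > 0" and
      st: "\<And>\<kappa> T p q. \<lbrakk>\<kappa> \<in> ball \<kappa>\<^sub>0 \<delta>; 0 < T; T \<le> 1; p \<in> ball (complex_of_real y) (c * T\<^sup>2);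
        q \<in> ball (complex_of_real y) (c * T\<^sup>2)\<rbrakk> \<Longrightarrow> steers n\<^sub>1 n\<^sub>2 s\<^sub>0 \<kappa> T (fin p) (fin q)"
      using steers_near_equilibrium [OF k0 y2] by metis
    have half: "fin p \<in> controllable_set n\<^sub>1 n\<^sub>2 s\<^sub>0 \<eta> \<kappa> t" "fin p \<in> reachable_set n\<^sub>1 n\<^sub>2 s\<^sub>0 \<eta> \<kappa> t"
      if \<kappa>: "\<kappa> \<in> ball \<kappa>\<^sub>0 \<delta>" and t: "0 < t" "t < 1" and p: "p \<in> ball (complex_of_real y) (c / 4 * t\<^sup>2)" for \<kappa> t p
    proof -
      have "p \<in> ball (complex_of_real y) (c * (t / 2)\<^sup>2)" "complex_of_real y \<in> ball (complex_of_real y) (c * (t / 2)\<^sup>2)"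
        using p t c by (simp_all add: power_divide)
      then have "steers n\<^sub>1 n\<^sub>2 s\<^sub>0 \<kappa> (t / 2) (fin p) \<eta>" "steers n\<^sub>1 n\<^sub>2 s\<^sub>0 \<kappa> (t / 2) \<eta> (fin p)"
        unfolding \<eta> using t by (auto intro!: st [OF \<kappa>])
      moreover have "t / 2 \<in> {0..<t}" using t by simp
      ultimately show "fin p \<in> controllable_set n\<^sub>1 n\<^sub>2 s\<^sub>0 \<eta> \<kappa> t" "fin p \<in> reachable_set n\<^sub>1 n\<^sub>2 s\<^sub>0 \<eta> \<kappa> t"
        unfolding controllable_set_def reachable_set_def by blast+
    qed
    have "stlc_to n\<^sub>1 n\<^sub>2 s\<^sub>0 \<eta> (ball \<kappa>\<^sub>0 \<delta>)" "stlc_from n\<^sub>1 n\<^sub>2 s\<^sub>0 \<eta> (ball \<kappa>\<^sub>0 \<delta>)"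
      unfolding stlc_to_def stlc_from_def
      using half c unfolding \<eta> by (auto intro!: uniform_disc_boundI [of "c / 4"] simp del: mem_ball)
    then show ?thesis using \<delta> by blast
  qed
  have necessary: "\<not> ?to \<and> \<not> ?from" if \<eta>: "\<not> ?in"
  proof -
    obtain t1 where t1: "0 < t1"
      and no_to: "\<And>r. 0 < r \<Longrightarrow> \<exists>p\<in>disc \<eta> r. \<forall>T\<in>{0..<t1}. \<not> steers n\<^sub>1 n\<^sub>2 s\<^sub>0 \<kappa>\<^sub>0 T p \<eta>"
      and no_from: "\<And>r. 0 < r \<Longrightarrow> \<exists>q\<in>disc \<eta> r. \<forall>T\<in>{0..<t1}. \<not> steers n\<^sub>1 n\<^sub>2 s\<^sub>0 \<kappa>\<^sub>0 T \<eta> q"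
      using uncontrollable_points [OF assms(1,2) \<kappa> \<eta>] by metis
    have centre: "\<kappa>\<^sub>0 \<in> ball \<kappa>\<^sub>0 \<delta>" if "\<delta> > 0" for \<delta> using that by simp
    show ?thesis
    proof (intro conjI notI)
      assume ?to
      then obtain \<delta> where \<delta>: "\<delta> > 0" and s: "uniform_disc_bound \<eta> (controllable_set n\<^sub>1 n\<^sub>2 s\<^sub>0 \<eta>) (ball \<kappa>\<^sub>0 \<delta>)"
        unfolding stlc_to_def by blast
      obtain t r where "0 < t" "t < t1" "0 < r" "disc \<eta> r \<subseteq> controllable_set n\<^sub>1 n\<^sub>2 s\<^sub>0 \<eta> \<kappa>\<^sub>0 t"
        by (rule uniform_disc_boundD [OF s centre [OF \<delta>] t1])
      then show False using no_to [of r] unfolding controllable_set_def by fastforce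
    next
      assume ?from
      then obtain \<delta> where \<delta>: "\<delta> > 0" and s: "uniform_disc_bound \<eta> (reachable_set n\<^sub>1 n\<^sub>2 s\<^sub>0 \<eta>) (ball \<kappa>\<^sub>0 \<delta>)"
        unfolding stlc_from_def by blast
      obtain t r where "0 < t" "t < t1" "0 < r" "disc \<eta> r \<subseteq> reachable_set n\<^sub>1 n\<^sub>2 s\<^sub>0 \<eta> \<kappa>\<^sub>0 t"
        by (rule uniform_disc_boundD [OF s centre [OF \<delta>] t1])
      then show False using no_from [of r] unfolding reachable_set_def by fastforce
    qed
  qed
  show ?thesis using sufficient necessary by blast
qed

end
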